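(* Fix $x=\Gamma g\in X$ and write $k_N=k_N(x)$, $M_N=N-k_N(x)$ for $N\ge0$. Let $\Phi:2\mathbb Z_{\ge0}\to\mathbb C$ and assume that, for some $C>0$, $|\Phi(2m)|\le Cq^{\alpha m}$ for all $m\ge0$, with $\alpha<2$. Put $\beta=(2-\alpha)/2$. Whenever $M_N\ge0$, the following estimates hold. (i) If $\alpha<1$, then $\left|\lambda^{\mathrm{den}}_{x,N}(\Phi\circ h_K)-\langle\Phi\rangle_{\rho^{\mathrm{ev}}}\right|\ll_{q,\alpha}Cq^{-M_N/2}$. (ii) If $\alpha=1$, then $\left|\lambda^{\mathrm{den}}_{x,N}(\Phi\circ h_K)-\langle\Phi\rangle_{\rho^{\mathrm{ev}}}\right|\ll_{q}C\,(M_N+k_N+1)\,q^{-M_N/2}$. (iii) If $1<\alpha<2$, then $\left|\lambda^{\mathrm{den}}_{x,N}(\Phi\circ h_K)-\langle\Phi\rangle_{\rho^{\mathrm{ev}}}\right|\ll_{q,\alpha}Cq^{-\beta M_N+(\alpha-1)k_N}$. Consequently, the convergence $\lambda^{\mathrm{den}}_{x,N}(\Phi\circ h_K)\to\langle\Phi\rangle_{\rho^{\mathrm{ev}}}$ as $N\to\infty$ holds in case (i) if $M_N\to\infty$, in case (ii) if $(M_N+k_N+1)q^{-M_N/2}\to0$, and in case (iii) if $-\frac{2-\alpha}{2}M_N+(\alpha-1)k_N\to-\infty$. For $1<\alpha<2$, a sufficient condition is that, for some $\vartheta\ge0$, $k_N\le\vartheta M_N$ eventually, with $\vartheta<\fr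ac{2-\alpha}{2(\alpha-1)}$.
   Context: Let $q$ be a prime power, $F=\mathbb F_q((t^{-1}))$, $\mathcal O=\mathbb F_q[[t^{-1}]]$, $\pi=t^{-1}$, $G=\mathrm{SL}_2(F)$, $\Gamma=\mathrm{SL}_2(\mathbb F_q[t])$, $K=\mathrm{SL}_2(\mathcal O)$, $X=\Gamma\backslash G$. Put $u(s)=\begin{pmatrix}1&s\\0&1\end{pmatrix}$ for $s\in F$, and let $ds$ be Haar measure on $F$ with $ds(\mathcal O)=1$. $\mathcal T$ is the Bruhat--Tits tree of $\mathrm{PGL}_2(F)$: vertices are homothety classes $[L]$ of $\mathcal O$-lattices in $F^2$, adjacent if representatives can be chosen with $\pi L\subsetneq L'\subsetneq L$, $L/L'\simeq\mathbb F_q$. Put $\bar a_n=[\mathrm{diag}(t^n,1)]$, $v_0=[\mathcal O^2]$, $v_n=\bar a_nv_0$. The quotient of $\mathcal T$ by $\mathrm{PGL}_2(\mathbb F_q[t])$ is a ray represented by $v_0-v_1-v_2-\cdots$, and $h(v)$ is the $n\ge0$ for which $v$ lies in the $\mathrm{PGL}_2(\mathbb F_q[t])$-orbit of $v_n$. The spherical height map is $h_K:X\to2\mathbb Z_{\ge0}$, $h_K(\Gamma g)=h(gv_0)$. For $x=\Gamma g$ and $N\ge0$: $\lambda^{\mathrm{den}}_{x,N}(f)=q^{-N}\int_{t^N\mathcal O}f(xu(s))\,ds$, and $k_N(x)=h(g\bar a_Nv_0)$ (independent of the lift $g$). $\rho^{\mathrm{ev}}$ on $2\mathbb Z_{\ge0}$: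 $\rho^{\mathrm{ev}}(0)=\frac{q-1}{q}$, $\rho^{\mathrm{ev}}(2m)=(q^2-1)q^{-2m-1}$ ($m\ge1$); $\langle\Phi\rangle_{\rho^{\mathrm{ev}}}=\sum_{m\ge0}\Phi(2m)\rho^{\mathrm{ev}}(2m)$. $A\ll_pB$ means $|A|\le C'B$ with $C'$ depending only on the indicated parameters $p$ (in particular not on $x$, $N$, $k_N$). *)

theory Defs
  imports
    "HOL-Analysis.Analysis"
    "HOL-Computational_Algebra.Formal_Laurent_Series"
begin

no_notation fps_nth (infixl \<open>$\<close> 75)

text \<open>
  The field \<open>F = F_q((1/t))\<close> is \<^typ>\<open>'a fls\<close> for a finite field \<^typ>\<open>'a\<close> with
  \<open>q = CARD('a)\<close>. The uniformiser \<open>1/t\<close> is \<^const>\<open>fls_X\<close>, so \<open>t\<close> is \<^const>\<open>fls_X_inv\<close>. The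
  library topology on \<^typ>\<open>'a fls\<close> is the \<open>1/t\<close>-adic one.
\<close>

abbreviation tt :: "'a::field fls" where
  "tt \<equiv> fls_X_inv"

definition ring_O :: "'a::field fls set" where
  "ring_O = range fps_to_fls"

text \<open>\<open>F_q[t]\<close> as a subring of \<open>F\<close>: all values \<open>p(t)\<close> of polynomials \<open>p\<close> over \<open>F_q\<close>.\<close>

definition poly_ring_t :: "'a::field fls set" where
  "poly_ring_t = range (\<lambda>p. poly (map_poly fls_const p) tt)"

subsection \<open>Groups\<close>

type_synonym 'a mat2 = "'a fls ^ 2 ^ 2"

definition mat2 :: "'a::field fls \<Rightarrow> 'a fls \<Rightarrow> 'a fls \<Rightarrow> 'a fls \<Rightarrow> 'a mat2" where
  "mat2 a b c d = vector [vector [a, b], vector [c, d]]"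

definition entries_in :: "'a::field fls set \<Rightarrow> 'a mat2 set" where
  "entries_in R = {A. \<forall>i j. A $ i $ j \<in> R}"

definition SL2_F :: "'a::field mat2 set" where
  "SL2_F = {g. det g = 1}"

definition Gamma_SL2 :: "'a::field mat2 set" where
  "Gamma_SL2 = entries_in poly_ring_t \<inter> SL2_F"

definition GL2_poly :: "'a::field mat2 set" where
  "GL2_poly = {A \<in> entries_in poly_ring_t.
     \<exists>B \<in> entries_in poly_ring_t. A ** B = mat 1 \<and> B ** A = mat 1}"

definition coset :: "'a::field mat2 \<Rightarrow> 'a mat2 set" where
  "coset g = {\<gamma> ** g | \<gamma>. \<gamma> \<in> Gamma_SL2}"

definition space_X :: "'a::field mat2 set set" where
  "space_X = coset ` SL2_F"

definition unip :: "'a::field fls \<Rightarrow> 'a mat2" where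
  "unip s = mat2 1 s 0 1"

definition abar :: "nat \<Rightarrow> 'a::field mat2" where
  "abar n = mat2 (tt ^ n) 0 0 1"

definition right_mult :: "'a::field mat2 set \<Rightarrow> 'a mat2 \<Rightarrow> 'a mat2 set" where
  "right_mult x g = (\<lambda>y. y ** g) ` x"

subsection \<open>Vertices of the tree and heights\<close>

definition O_span :: "('a::field fls ^ 2) set \<Rightarrow> ('a fls ^ 2) set" where
  "O_span S = {\<Sum>w\<in>S. c w *s w | c. \<forall>w\<in>S. c w \<in> ring_O}"

definition is_lattice :: "('a::field fls ^ 2) set \<Rightarrow> bool" where
  "is_lattice L \<longleftrightarrow> (\<exists>S. finite S \<and> L = O_span S) \<and> vec.span L = UNIV"

definition homothety_class :: "('a::field fls ^ 2) set \<Rightarrow> ('a fls ^ 2) set set" where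
  "homothety_class L = {(\<lambda>w. c *s w) ` L | c. c \<noteq> 0}"

definition vertices :: "('a::field fls ^ 2) set set set" where
  "vertices = {homothety_class L | L. is_lattice L}"

definition act :: "'a::field mat2 \<Rightarrow> ('a fls ^ 2) set set \<Rightarrow> ('a fls ^ 2) set set" where
  "act g V = (\<lambda>L. (\<lambda>w. g *v w) ` L) ` V"

definition v0 :: "('a::field fls ^ 2) set set" where
  "v0 = homothety_class {w. \<forall>i. w $ i \<in> ring_O}"

text \<open>
  Scalar matrices fix every vertex, and \<open>PGL_2(F_q[t])\<close> is \<open>GL_2(F_q[t])\<close> modulo scalars because
  \<open>F_q[t]\<close> is a principal ideal domain. So \<open>PGL_2(F_q[t])\<close>-orbits are \<open>GL_2(F_q[t])\<close>-orbits.
\<close>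

definition height :: "('a::field fls ^ 2) set set \<Rightarrow> nat" where
  "height v = (THE n. \<exists>\<gamma>\<in>GL2_poly. v = act \<gamma> (act (abar n) v0))"

text \<open>
  The maps \<open>h_K\<close> and \<open>k_N\<close> are computed on any representative of the coset \<open>x\<close>; see
  \<open>height_K_coset\<close> and \<open>k_index_coset\<close> below.
\<close>

definition height_K :: "'a::field mat2 set \<Rightarrow> nat" where
  "height_K x = (THE n. \<exists>g\<in>x. n = height (act g v0))"

definition k_index :: "'a::field mat2 set \<Rightarrow> nat \<Rightarrow> nat" where
  "k_index x N = (THE n. \<exists>g\<in>x. n = height (act (g ** abar N) v0))"

definition M_index :: "'a::field mat2 set \<Rightarrow> nat \<Rightarrow> int" where
  "M_index x N = int N - int (k_index x N)"

subsection \<open>Averages\<close>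

text \<open>
  A translation invariant Borel measure with \<open>\<mu>(O) = 1\<close> is finite on compact sets, since these are
  covered by finitely many translates of \<open>O\<close>; as \<open>F\<close> is locally compact and second countable, this
  is the normalised Haar measure.
\<close>

definition normalized_haar :: "'a::field fls measure \<Rightarrow> bool" where
  "normalized_haar \<mu> \<longleftrightarrow>
     sets \<mu> = sets borel \<and>
     (\<forall>s. \<forall>A\<in>sets borel. emeasure \<mu> ((\<lambda>z. s + z) ` A) = emeasure \<mu> A) \<and>
     emeasure \<mu> ring_O = 1"

definition lambda_den ::
  "'a::{finite,field} fls measure \<Rightarrow> 'a mat2 set \<Rightarrow> nat \<Rightarrow> ('a mat2 set \<Rightarrow> complex) \<Rightarrow> complex" where
  "lambda_den \<mu> x N f =
     (LINT s : (\<lambda>z. tt ^ N * z) ` ring_O | \<mu>. f (right_mult x (unip s))) / of_nat (CARD('a) ^ N)"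

text \<open>A function on \<open>2\<int>\<^sub>\<ge>\<^sub>0\<close> is encoded as a function on \<^typ>\<open>nat\<close> whose values at odd
  arguments are never used; \<open>rho_ev q\<close> is likewise only meaningful at even arguments.\<close>

definition rho_ev :: "nat \<Rightarrow> nat \<Rightarrow> real" where
  "rho_ev q n = (if n = 0 then (real q - 1) / real q else ((real q)\<^sup>2 - 1) / real q ^ (n + 1))"

definition mean_ev :: "nat \<Rightarrow> (nat \<Rightarrow> complex) \<Rightarrow> complex" where
  "mean_ev q \<Phi> = (\<Sum>m. \<Phi> (2 * m) * of_real (rho_ev q (2 * m)))"

definition growth_bound :: "nat \<Rightarrow> real \<Rightarrow> real \<Rightarrow> (nat \<Rightarrow> complex) \<Rightarrow> bool" where
  "growth_bound q \<alpha> C \<Phi> \<longleftrightarrow> (\<forall>m. norm (\<Phi> (2 * m)) \<le> C * real q powr (\<alpha> * real m))"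

definition discrepancy ::
  "'a::{finite,field} fls measure \<Rightarrow> 'a mat2 set \<Rightarrow> (nat \<Rightarrow> complex) \<Rightarrow> nat \<Rightarrow> real" where
  "discrepancy \<mu> x \<Phi> N = norm (lambda_den \<mu> x N (\<Phi> \<circ> height_K) - mean_ev CARD('a) \<Phi>)"

subsection \<open>Independence of representatives\<close>

lemma fls_const_sum: "fls_const (sum f A) = (\<Sum>i\<in>A. fls_const (f i))"
proof (induction A rule: infinite_finite_induct)
  case (insert x F)
  have "fls_const (a + b) = fls_const a + fls_const b" for a b :: 'a
    by (intro fls_eqI) simp
  with insert show ?case by simp
qed simp_all

lemma map_poly_fls_const_add:
  "map_poly fls_const (p + q) = map_poly fls_const p + map_poly fls_const (q :: 'a::field poly)"
  by (intro poly_eqI fls_eqI) (simp add: coeff_map_poly)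

lemma map_poly_fls_const_mult:
  "map_poly fls_const (p * q) = map_poly fls_const p * map_poly fls_const (q :: 'a::field poly)"
  by (intro poly_eqI) (simp add: coeff_map_poly coeff_mult fls_const_sum)

lemma poly_ring_t_add: "a \<in> poly_ring_t \<Longrightarrow> b \<in> poly_ring_t \<Longrightarrow> a + b \<in> poly_ring_t"
  unfolding poly_ring_t_def by (auto simp flip: poly_add map_poly_fls_const_add)

lemma poly_ring_t_mult: "a \<in> poly_ring_t \<Longrightarrow> b \<in> poly_ring_t \<Longrightarrow> a * b \<in> poly_ring_t"
  unfolding poly_ring_t_def by (auto simp flip: poly_mult map_poly_fls_const_mult)

lemma poly_ring_t_uminus:
  assumes "a \<in> poly_ring_t"
  shows "- a \<in> poly_ring_t"
proof -
  obtain p where p: "a = poly (map_poly fls_const p) tt"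
    using assms by (auto simp: poly_ring_t_def)
  have "map_poly fls_const (- p) = - map_poly fls_const p"
    by (intro poly_eqI) (simp add: coeff_map_poly)
  then have "- a = poly (map_poly fls_const (- p)) tt"
    using p by simp
  then show ?thesis by (auto simp: poly_ring_t_def)
qed

lemma poly_ring_t_1: "1 \<in> poly_ring_t"
proof -
  have "1 = poly (map_poly fls_const 1) tt" by simp
  then show ?thesis unfolding poly_ring_t_def by blast
qed

lemma poly_ring_t_0: "0 \<in> poly_ring_t"
  using poly_ring_t_add[OF poly_ring_t_uminus[OF poly_ring_t_1] poly_ring_t_1] by simp

lemma entries_in_mult:
  assumes "A \<in> entries_in poly_ring_t" "B \<in> entries_in poly_ring_t"
  shows "A ** B \<in> entries_in poly_ring_t"
  using assms unfolding entries_in_def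
  by (auto simp: matrix_matrix_mult_def sum_2 intro!: poly_ring_t_add poly_ring_t_mult)

lemma GL2_poly_mult:
  assumes "A \<in> GL2_poly" "B \<in> GL2_poly"
  shows "A ** B \<in> GL2_poly"
proof -
  obtain A' B' where A': "A' \<in> entries_in poly_ring_t" "A ** A' = mat 1" "A' ** A = mat 1"
    and B': "B' \<in> entries_in poly_ring_t" "B ** B' = mat 1" "B' ** B = mat 1"
    using assms by (auto simp: GL2_poly_def)
  have "(A ** B) ** (B' ** A') = A ** (B ** B') ** A'" "(B' ** A') ** (A ** B) = B' ** (A' ** A) ** B"
    by (simp_all add: matrix_mul_assoc)
  then have "(A ** B) ** (B' ** A') = mat 1" "(B' ** A') ** (A ** B) = mat 1"
    using A' B' by simp_all
  moreover have "A ** B \<in> entries_in poly_ring_t" "B' ** A' \<in> entries_in poly_ring_t"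
    using assms A' B' by (auto simp: GL2_poly_def intro: entries_in_mult)
  ultimately show ?thesis
    unfolding GL2_poly_def by blast
qed

lemma GL2_poly_inverse:
  assumes "A \<in> GL2_poly"
  obtains B where "B \<in> GL2_poly" "A ** B = mat 1" "B ** A = mat 1"
  using assms unfolding GL2_poly_def by blast

lemma Gamma_SL2_subset_GL2_poly: "Gamma_SL2 \<subseteq> GL2_poly"
proof
  fix A :: "'a mat2"
  assume "A \<in> Gamma_SL2"
  then have A: "A \<in> entries_in poly_ring_t" "det A = 1"
    by (auto simp: Gamma_SL2_def SL2_F_def)
  define B where "B = mat2 (A$2$2) (- A$1$2) (- A$2$1) (A$1$1)"
  have d: "A$1$1 * A$2$2 - A$1$2 * A$2$1 = 1"
    using A(2) by (simp add: det_2)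
  have B: "B \<in> entries_in poly_ring_t"
    using A(1) by (auto simp: entries_in_def B_def mat2_def forall_2 intro: poly_ring_t_uminus)
  have "A ** B = mat 1" "B ** A = mat 1"
    using d by (simp_all add: vec_eq_iff forall_2 matrix_matrix_mult_def sum_2 mat_def B_def
        mat2_def algebra_simps)
  with A B show "A \<in> GL2_poly"
    unfolding GL2_poly_def by blast
qed

lemma act_mult: "act (A ** B) V = act A (act B V)"
  by (simp add: act_def image_image matrix_vector_mul_assoc)

lemma act_one: "act (mat 1) V = V"
  by (simp add: act_def)

lemma height_act_GL2_poly:
  assumes "\<gamma> \<in> GL2_poly"
  shows "height (act \<gamma> v) = height v"
proof -
  obtain \<delta> where \<delta>: "\<delta> \<in> GL2_poly" "\<gamma> ** \<delta> = mat 1" "\<delta> ** \<gamma> = mat 1"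
    using assms by (rule GL2_poly_inverse)
  have "(\<exists>\<eta>\<in>GL2_poly. act \<gamma> v = act \<eta> w) \<longleftrightarrow> (\<exists>\<eta>\<in>GL2_poly. v = act \<eta> w)" for w
  proof
    assume "\<exists>\<eta>\<in>GL2_poly. act \<gamma> v = act \<eta> w"
    then obtain \<eta> where \<eta>: "\<eta> \<in> GL2_poly" "act \<gamma> v = act \<eta> w" by blast
    have "v = act (\<delta> ** \<eta>) w"
      using \<eta>(2) \<delta>(3) by (metis act_mult act_one)
    with \<eta>(1) \<delta>(1) show "\<exists>\<eta>\<in>GL2_poly. v = act \<eta> w"
      using GL2_poly_mult by blast
  next
    assume "\<exists>\<eta>\<in>GL2_poly. v = act \<eta> w"
    then show "\<exists>\<eta>\<in>GL2_poly. act \<gamma> v = act \<eta> w"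
      using assms by (metis act_mult GL2_poly_mult)
  qed
  then show ?thesis
    by (simp add: height_def)
qed

lemma coset_self: "g \<in> coset g"
proof -
  have "mat 1 \<in> Gamma_SL2"
    using poly_ring_t_1 poly_ring_t_0 by (simp add: Gamma_SL2_def SL2_F_def entries_in_def) (auto simp: mat_def)
  then show ?thesis
    unfolding coset_def by (metis (mono_tags, lifting) matrix_mul_lid mem_Collect_eq)
qed

lemma height_coset:
  assumes "g' \<in> coset g"
  shows "height (act (g' ** a) v) = height (act (g ** a) v)"
proof -
  obtain \<gamma> where \<gamma>: "\<gamma> \<in> Gamma_SL2" "g' = \<gamma> ** g"
    using assms by (auto simp: coset_def)
  have "act (g' ** a) v = act \<gamma> (act (g ** a) v)"
    by (simp add: \<gamma>(2) act_mult)
  then show ?thesis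
    using \<gamma>(1) Gamma_SL2_subset_GL2_poly height_act_GL2_poly by (metis subsetD)
qed

lemma k_index_coset: "k_index (coset g) N = height (act (g ** abar N) v0)"
  unfolding k_index_def
  by (rule the_equality) (use coset_self height_coset in blast)+

lemma height_K_coset: "height_K (coset g) = height (act g v0)"
  unfolding height_K_def
proof (rule the_equality)
  show "\<exists>g'\<in>coset g. height (act g v0) = height (act g' v0)"
    using coset_self by blast
  fix n assume "\<exists>g'\<in>coset g. n = height (act g' v0)"
  then show "n = height (act g v0)"
    using height_coset[where a = "mat 1" and v = v0] by auto
qed

lemma right_mult_coset: "right_mult (coset g) a = coset (g ** a)"
  by (auto simp: right_mult_def coset_def image_def) (metis matrix_mul_assoc)+

subsection \<open>Sanity check: the vertices that occur are vertices\<close>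

lemma ring_O_0: "0 \<in> ring_O" and ring_O_1: "1 \<in> ring_O"
  unfolding ring_O_def by (metis fps_zero_to_fls rangeI, metis fps_one_to_fls rangeI)

lemma act_v0:
  "act g v0 = homothety_class ((\<lambda>w. g *v w) ` {w. \<forall>i. w $ i \<in> ring_O})"
  by (simp add: act_def v0_def homothety_class_def setcompr_eq_image image_image
      matrix_vector_mult_scaleR vec.scale)

lemma act_v0_vertex:
  fixes g :: "'a::field mat2"
  assumes "invertible g"
  shows "act g v0 \<in> vertices"
proof -
  define L where "L = (\<lambda>w. g *v w) ` {w. \<forall>i. w $ i \<in> ring_O}"
  obtain B where B: "g ** B = mat 1" "B ** g = mat 1"
    using assms by (auto simp: invertible_def)
  have mv: "g *v w = w $ 1 *s column 1 g + w $ 2 *s column 2 g" for w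
    by (simp add: vec_eq_iff matrix_vector_mult_def column_def sum_2 mult.commute)
  have inj: "inj ((*v) g)"
    using B(2) matrix_left_invertible_injective by blast
  have ax: "column i g = g *v axis i 1" for i
    by (simp add: vec_eq_iff matrix_vector_mult_def column_def axis_def if_distrib cong: if_cong)
  have ne: "column 1 g \<noteq> column 2 g"
    using inj by (auto simp: ax inj_eq axis_eq_axis)
  have cols: "columns g = {column 1 g, column 2 g}"
    by (auto simp: columns_def UNIV_2)
  have "O_span (columns g) = L"
  proof (intro equalityI subsetI)
    fix y assume "y \<in> O_span (columns g)"
    then obtain c where c: "y = (\<Sum>w\<in>columns g. c w *s w)" "\<forall>w\<in>columns g. c w \<in> ring_O"
      by (auto simp: O_span_def)
    have "y = g *v vector [c (column 1 g), c (column 2 g)]"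
      using ne by (simp add: c(1) cols mv)
    moreover have "vector [c (column 1 g), c (column 2 g)] \<in> {w :: 'a fls ^ 2. \<forall>i. w $ i \<in> ring_O}"
      using c(2) by (simp add: forall_2 cols)
    ultimately show "y \<in> L" by (simp add: L_def)
  next
    fix y assume "y \<in> L"
    then obtain w where w: "y = g *v w" "\<forall>i. w $ i \<in> ring_O"
      by (auto simp: L_def)
    define c where "c z = (if z = column 1 g then w $ 1 else w $ 2)" for z
    have "y = (\<Sum>z\<in>columns g. c z *s z)"
      using ne by (simp add: w(1) cols mv c_def)
    moreover have "\<forall>z\<in>columns g. c z \<in> ring_O"
      using w(2) by (simp add: c_def)
    ultimately show "y \<in> O_span (columns g)"
      unfolding O_span_def by blast
  qed
  moreover have "vec.span L = UNIV"
  proof -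
    have "columns g \<subseteq> L"
      unfolding cols ax L_def by (auto simp: axis_def ring_O_0 ring_O_1)
    moreover have "vec.span (columns g) = UNIV"
      using B(1) matrix_right_invertible_span_columns by blast
    ultimately show ?thesis
      using vec.span_mono by blast
  qed
  ultimately have "is_lattice L"
    unfolding is_lattice_def by (metis finite.emptyI finite.insertI cols)
  then show ?thesis
    unfolding vertices_def act_v0 L_def by blast
qed

end

theory Submission
  imports Defs
begin

text \<open>
  The vertices \<open>g u(s) v_0\<close> with \<open>s\<close> in \<open>t^N O\<close> are the \<open>q^N\<close> endpoints of the paths of
  length \<open>N\<close> without backtracking that start at \<open>g v_N\<close> and do not begin with the step to
  \<open>g v_(N+1)\<close>. Hence \<open>\<lambda>\<^sup>d\<^sup>e\<^sup>n(\<Phi> \<circ> h_K)\<close> is the average of \<open>\<Phi>\<close> over the heights of these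
  endpoints (\<open>lambda_den_eq_branch_sum\<close>), and \<open>k\<close> is the height of the starting vertex.

  Heights along such paths are easy to follow, since the quotient of the tree is a ray: a vertex of
  height \<open>n > 0\<close> has one neighbour of height \<open>n + 1\<close> and \<open>q\<close> of height \<open>n - 1\<close>, and a vertex of
  height 0 has only neighbours of height 1. A path that has begun to descend must descend to
  height 0; a path that ascends from a positive height turns downwards at the next step in \<open>q - 1\<close>
  of \<open>q\<close> cases. This gives
  recursions for the sums \<open>D_n(N)\<close> and \<open>U_n(N)\<close> of \<open>\<Phi>\<close> over the branches at a vertex of height
  \<open>n\<close> whose upper, respectively one lower, neighbour is excluded (\<open>branch_sum_down\<close>,
  \<open>branch_sum_turn\<close>, \<open>branch_sum_up\<close>).

  The recursions have an exact solution (\<open>branch_sum_closed_form\<close>). Let \<open>T_r\<close> be the mean of \<open>\<Phi>\<close>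
  for the measure \<open>\<rho>\<^sup>e\<^sup>v\<close> with all mass beyond \<open>2 r\<close> moved to \<open>2 r\<close>. With \<open>N = k + 2 r\<close>, the
  average is either \<open>T_r\<close> or
  \<open>T_r + (\<Sum>i<k. q^i (T_(r+i+1) - T_(r+i)))\<close>, according to the direction excluded at the start.
  The growth condition gives \<open>|T_(r+1) - T_r| \<le> A C q^((\<alpha>-2) r)\<close> with a constant \<open>A\<close>, and \<open>T_r\<close>
  tends to \<open>\<langle>\<Phi>\<rangle>\<close>. Summing geometric series, the discrepancy is at most a constant times
  \<open>C q^(-(2-\<alpha>) r) (1 + (\<Sum>i<k. q^((\<alpha>-1) i)))\<close> (\<open>discrepancy_bound\<close>). As \<open>M = 2 r\<close>, the
  three regimes are those in which the last geometric sum is bounded, equal to \<open>k\<close>, or dominated by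
  its last term.

  To carry out the geometry with matrices, a directed edge of the tree is represented by a coset of
  the Iwahori subgroup, and steps by right multiplication with explicit matrices. The
  decomposition \<open>reducible_of_det\<close> and the uniqueness statement \<open>height_abar\<close> identify
  the quotient with the ray.
\<close>

notation fls_nth (infixl \<open>$$\<close> 75)

section \<open>Integers, residues and polynomials in \<open>F\<close>\<close>

lemma ring_O_iff: "x \<in> ring_O \<longleftrightarrow> 0 \<le> fls_subdegree x"
proof
  assume "x \<in> ring_O"
  then show "0 \<le> fls_subdegree x"
    by (auto simp: ring_O_def fls_subdegree_fls_to_fps_gt0)
next
  assume "0 \<le> fls_subdegree x"
  then have "x = fps_to_fls (fls_regpart x)"
    by simp
  then show "x \<in> ring_O"
    unfolding ring_O_def by blast
qed

lemma ring_O_nth: "x \<in> ring_O \<longleftrightarrow> (\<forall>n<0. x $$ n = 0)"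
  unfolding ring_O_iff using fls_subdegree_ge0I[of x] by auto

lemma ring_O_add: "x \<in> ring_O \<Longrightarrow> y \<in> ring_O \<Longrightarrow> x + y \<in> ring_O"
  and ring_O_diff: "x \<in> ring_O \<Longrightarrow> y \<in> ring_O \<Longrightarrow> x - y \<in> ring_O"
  and ring_O_uminus: "x \<in> ring_O \<Longrightarrow> - x \<in> ring_O"
  for x :: "'a::field fls"
  by (simp_all add: ring_O_nth)

lemma ring_O_mult: "x \<in> ring_O \<Longrightarrow> y \<in> ring_O \<Longrightarrow> x * y \<in> ring_O"
  by (simp add: ring_O_iff fls_mult_subdegree_ge_0)

lemma ring_O_const: "fls_const c \<in> ring_O"
  and ring_O_X: "fls_X \<in> ring_O"
  by (simp_all add: ring_O_iff)

lemmas ring_O_intros = ring_O_0 ring_O_1 ring_O_add ring_O_diff ring_O_uminus ring_O_mult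
  ring_O_const ring_O_X

lemma residue_mult:
  assumes "x \<in> ring_O" "y \<in> ring_O"
  shows "(x * y) $$ 0 = x $$ 0 * y $$ (0 :: int)"
proof -
  obtain f g where "x = fps_to_fls f" "y = fps_to_fls g"
    using assms by (auto simp: ring_O_def)
  then show ?thesis
    by (simp flip: fls_times_fps_to_fls)
qed

lemma ring_O_inverse:
  assumes "x \<in> ring_O" "x $$ 0 \<noteq> 0"
  shows "inverse x \<in> ring_O"
proof -
  have "fls_subdegree x = 0"
    using assms fls_subdegree_leI by (fastforce simp: ring_O_iff)
  then show ?thesis
    by (simp add: ring_O_iff)
qed

lemma tt_mult_ring_O:
  assumes "x \<in> ring_O" "x $$ 0 = 0"
  shows "tt * x \<in> ring_O"
proof -
  have "x $$ (n + 1) = 0" if "n < 0" for n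
    using assms that by (cases "n = - 1") (simp_all add: ring_O_nth)
  then show ?thesis
    by (simp add: ring_O_nth fls_X_inv_times_conv_shift)
qed

lemma X_tt: "fls_X * tt = (1 :: 'a fls)" "tt * fls_X = (1 :: 'a fls)" "fls_X * (tt * x) = x" "tt * (fls_X * x) = x"
  for x :: "'a::field fls"
proof -
  have *: "fls_X * (tt * x) = x" "tt * (fls_X * x) = x" for x :: "'a fls"
    by (simp_all add: fls_X_times_conv_shift fls_X_inv_times_conv_shift)
  then show "fls_X * (tt * x) = x" "tt * (fls_X * x) = x"
    by blast+
  show "fls_X * tt = (1 :: 'a fls)" "tt * fls_X = (1 :: 'a fls)"
    using *[of 1] by simp_all
qed

lemma tt_power_X_power: "tt ^ n * (fls_X ^ n * x) = x"
  for x :: "'a::field fls"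
  by (simp flip: power_mult_distrib mult.assoc add: X_tt)

lemma poly_ring_t_monomial: "fls_const c * tt ^ n \<in> poly_ring_t"
  for c :: "'a::field"
proof -
  have "fls_const c * tt ^ n = poly (map_poly fls_const (monom c n)) tt"
    by (simp add: map_poly_monom poly_monom)
  then show ?thesis
    unfolding poly_ring_t_def by blast
qed

text \<open>
  The coefficient of \<open>fls_X ^ n\<close> is the coefficient of \<open>t ^ (- n)\<close>. A nonzero polynomial in
  \<open>t\<close> therefore has subdegree at most 0; this is the form in which the discreteness of
  \<open>F_q[t]\<close> in \<open>F\<close> enters.
\<close>
lemma poly_ring_t_nth:
  fixes x :: "'a::field fls"
  assumes "x \<in> poly_ring_t" "0 < n"
  shows "x $$ n = 0"
proof -
  obtain p where p: "x = poly (map_poly fls_const p) tt"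
    using assms by (auto simp: poly_ring_t_def)
  have "\<forall>n>0. poly (map_poly fls_const p) tt $$ n = 0"
  proof (induction p)
    case (pCons a p)
    then show ?case
      by (auto simp: map_poly_pCons fls_X_inv_times_conv_shift)
  qed simp
  with p assms show ?thesis by blast
qed

lemma poly_ring_t_subdegree:
  assumes "x \<in> poly_ring_t"
  shows "fls_subdegree x \<le> 0"
  using poly_ring_t_nth[OF assms, of "fls_subdegree x"]
  by (cases "x = 0") (auto simp: not_le dest: linorder_not_less[THEN iffD1])

section \<open>Two by two matrices\<close>

lemma mat2_nth [simp]:
  "mat2 a b c d $ 1 $ 1 = a" "mat2 a b c d $ 1 $ 2 = b"
  "mat2 a b c d $ 2 $ 1 = c" "mat2 a b c d $ 2 $ 2 = d"
  by (simp_all add: mat2_def)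

lemma mat2_cases: obtains a b c d where "A = mat2 a b c d"
proof -
  have "A = mat2 (A$1$1) (A$1$2) (A$2$1) (A$2$2)"
    by (simp add: vec_eq_iff forall_2)
  then show ?thesis using that by blast
qed

lemma mat2_eq_iff [simp]:
  "mat2 a b c d = mat2 a' b' c' d' \<longleftrightarrow> a = a' \<and> b = b' \<and> c = c' \<and> d = d'"
  by (auto simp: vec_eq_iff forall_2)

lemma mat2_mult [simp]:
  "mat2 a b c d ** mat2 a' b' c' d' =
     mat2 (a * a' + b * c') (a * b' + b * d') (c * a' + d * c') (c * b' + d * d')"
  by (simp add: vec_eq_iff forall_2 matrix_matrix_mult_def sum_2)

lemma mat_conv_mat2: "(mat c :: 'a::field mat2) = mat2 c 0 0 c"
  by (simp add: vec_eq_iff forall_2 mat_def)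

lemma det_mat2 [simp]: "det (mat2 a b c d) = a * d - b * c"
  by (simp add: det_2)

lemma mat2_in_entries [simp]:
  "mat2 a b c d \<in> entries_in R \<longleftrightarrow> a \<in> R \<and> b \<in> R \<and> c \<in> R \<and> d \<in> R"
  by (auto simp: entries_in_def forall_2)

lemma mat_commute: "mat c ** A = A ** mat c"
  for A :: "'a::field mat2"
  by (cases A rule: mat2_cases) (simp add: mat_conv_mat2 mult.commute)

definition swap :: "'a::field mat2" where
  "swap = mat2 0 1 1 0"

text \<open>
  Right multiplication by \<open>shrink\<close> moves the base vertex one step away from \<open>v_1\<close>, the
  neighbour of \<open>v_0\<close> in the direction of the end fixed by all \<open>unip s\<close>.
\<close>
definition shrink :: "'a::field mat2" where
  "shrink = mat2 fls_X 0 0 1"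

lemma swap_swap: "swap ** swap = (mat 1 :: 'a::field mat2)" "swap ** (swap ** A) = (A :: 'a::field mat2)"
  by (simp_all add: swap_def mat_conv_mat2 matrix_mul_assoc)
     (simp flip: mat_conv_mat2)

lemma swap_GL2_poly: "swap \<in> GL2_poly"
  unfolding GL2_poly_def using swap_swap(1)
  by (auto simp: poly_ring_t_0 poly_ring_t_1 swap_def intro!: bexI[of _ swap])

lemma unip_GL2_poly:
  assumes "s \<in> poly_ring_t"
  shows "unip s \<in> GL2_poly"
  unfolding GL2_poly_def using assms
  by (auto simp: poly_ring_t_0 poly_ring_t_1 poly_ring_t_uminus unip_def mat_conv_mat2
      intro!: bexI[of _ "mat2 1 (- s) 0 1"])

lemma abar_0: "abar 0 = mat 1"
  by (simp add: abar_def mat_conv_mat2)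

lemma abar_unip: "abar n ** unip s = unip (tt ^ n * s) ** abar n"
  by (simp add: abar_def unip_def)

lemma abar_Suc_shrink: "abar (Suc n) ** shrink = abar n"
  by (simp add: abar_def shrink_def mult.assoc mult.commute[of tt] X_tt)

section \<open>Maximal compact and Iwahori subgroups\<close>

text \<open>
  The maximal compact subgroup \<open>GL_2(O)\<close> fixes \<open>v_0\<close>; the condition on the determinant says
  that it is a unit of \<open>O\<close>. The Iwahori subgroup also fixes the neighbour \<open>v_1\<close>, so it
  permutes the remaining \<open>q\<close> neighbours \<open>unip c ** shrink\<close> applied to \<open>v_0\<close>, with \<open>c\<close> in
  \<open>F_q\<close>.
\<close>
definition GL2_O :: "'a::field mat2 set" where
  "GL2_O = {A \<in> entries_in ring_O. det A $$ 0 \<noteq> 0}"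

definition iwahori :: "'a::field mat2 set" where
  "iwahori = {A \<in> GL2_O. (A $ 2 $ 1) $$ 0 = 0}"

lemma mat2_in_GL2_O:
  "mat2 a b c d \<in> GL2_O \<longleftrightarrow> a \<in> ring_O \<and> b \<in> ring_O \<and> c \<in> ring_O \<and> d \<in> ring_O \<and>
     a $$ 0 * d $$ 0 \<noteq> b $$ 0 * c $$ 0"
  by (auto simp: GL2_O_def residue_mult)

lemma mat2_in_iwahori:
  "mat2 a b c d \<in> iwahori \<longleftrightarrow> a \<in> ring_O \<and> b \<in> ring_O \<and> c \<in> ring_O \<and> d \<in> ring_O \<and>
     a $$ 0 \<noteq> 0 \<and> d $$ 0 \<noteq> 0 \<and> c $$ 0 = 0"
  by (auto simp: iwahori_def mat2_in_GL2_O)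

lemma GL2_O_mult:
  assumes "A \<in> GL2_O" "B \<in> GL2_O"
  shows "A ** B \<in> GL2_O"
proof -
  have det: "det A \<in> ring_O" if "A \<in> GL2_O" for A :: "'a mat2"
    using that by (cases A rule: mat2_cases) (auto simp: mat2_in_GL2_O intro: ring_O_intros)
  have "det (A ** B) $$ 0 \<noteq> 0"
    using assms det by (simp add: det_mul residue_mult) (simp add: GL2_O_def)
  moreover have "A ** B \<in> entries_in ring_O"
    using assms by (cases A rule: mat2_cases; cases B rule: mat2_cases)
      (auto simp: mat2_in_GL2_O intro: ring_O_intros)
  ultimately show ?thesis
    by (simp add: GL2_O_def)
qed

lemma swap_GL2_O: "swap \<in> GL2_O"
  by (simp add: swap_def mat2_in_GL2_O ring_O_intros)

lemma iwahori_subset: "iwahori \<subseteq> GL2_O"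
  by (auto simp: iwahori_def)

lemma mat_1_GL2_O: "mat 1 \<in> GL2_O"
  by (simp add: mat_conv_mat2 mat2_in_GL2_O ring_O_intros)

text \<open>
  Reduction modulo \<open>1/t\<close> turns this into the Bruhat decomposition of \<open>GL_2(F_q)\<close>: the two
  cases say whether or not \<open>k\<close> fixes the point of the projective line given by \<open>v_1\<close>.
\<close>
lemma GL2_O_Bruhat:
  assumes "k \<in> GL2_O"
  obtains "k \<in> iwahori"
    | b i where "i \<in> iwahori" "k = unip (fls_const b) ** swap ** i"
proof -
  obtain a b c d where k: "k = mat2 a b c d"
    by (rule mat2_cases)
  show ?thesis
  proof (cases "c $$ 0 = 0")
    case True
    with that(1) assms show ?thesis by (simp add: iwahori_def k)
  next
    case False
    define r where "r = a $$ 0 / c $$ 0"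
    define i where "i = mat2 c d (a - fls_const r * c) (b - fls_const r * d)"
    have "i \<in> iwahori"
      using assms False
      by (auto simp: i_def k mat2_in_iwahori mat2_in_GL2_O residue_mult r_def field_simps
          intro!: ring_O_intros)
    moreover have "k = unip (fls_const r) ** swap ** i"
      by (simp add: k unip_def swap_def i_def)
    ultimately show ?thesis
      using that(2) by blast
  qed
qed

section \<open>Heights of vertices\<close>

abbreviation lattice_O2 :: "('a::field fls ^ 2) set" where
  "lattice_O2 \<equiv> {w. \<forall>i. w $ i \<in> ring_O}"

lemma mat_mult_vec: "mat c *v w = c *s (w :: 'a::field fls ^ 2)"
  by (simp add: vec_eq_iff forall_2 matrix_vector_mult_def sum_2 mat_def)

lemma mat_mat: "mat c ** mat d = (mat (c * d) :: 'a::field mat2)"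
  by (simp add: mat_conv_mat2)

lemma mat2_mult_vec:
  "(mat2 a b c d *v w) $ 1 = a * w $ 1 + b * w $ 2"
  "(mat2 a b c d *v w) $ 2 = c * w $ 1 + d * w $ 2"
  by (simp_all add: matrix_vector_mult_def sum_2)

lemma entries_in_ring_O_vec:
  assumes "k \<in> entries_in ring_O" "w \<in> lattice_O2"
  shows "k *v w \<in> lattice_O2"
  using assms by (cases k rule: mat2_cases)
    (auto simp: forall_2 mat2_mult_vec intro!: ring_O_intros)

lemma mem_act_v0_iff:
  fixes A :: "'a::field mat2"
  shows "L \<in> act A v0 \<longleftrightarrow> (\<exists>c. c \<noteq> 0 \<and> L = (\<lambda>w. (A ** mat c) *v w) ` lattice_O2)"
  by (auto simp: act_def v0_def homothety_class_def setcompr_eq_image image_image mat_mult_vec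
      simp flip: matrix_vector_mul_assoc)

lemma act_mat_v0:
  fixes c :: "'a::field fls"
  assumes "c \<noteq> 0"
  shows "act (mat c) v0 = v0"
proof
  show "act (mat c) v0 \<subseteq> v0"
  proof
    fix L assume "L \<in> act (mat c) v0"
    then obtain d where "d \<noteq> 0" "L = (\<lambda>w. mat (c * d) *v w) ` lattice_O2"
      unfolding mem_act_v0_iff mat_mat by blast
    with assms have "L \<in> act (mat 1) v0"
      unfolding mem_act_v0_iff mat_mat by (intro exI[of _ "c * d"]) simp
    then show "L \<in> v0"
      by (simp add: act_one)
  qed
  show "v0 \<subseteq> act (mat c) v0"
  proof
    fix L :: "('a fls ^ 2) set" assume "L \<in> v0"
    then have "L \<in> act (mat 1) v0"
      by (simp add: act_one)
    then obtain d where "d \<noteq> 0" "L = (\<lambda>w. mat d *v w) ` lattice_O2"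
      unfolding mem_act_v0_iff by auto
    with assms show "L \<in> act (mat c) v0"
      unfolding mem_act_v0_iff mat_mat by (intro exI[of _ "d / c"]) simp
  qed
qed

lemma act_GL2_O_v0:
  fixes k :: "'a::field mat2"
  assumes "k \<in> GL2_O"
  shows "act k v0 = v0"
proof -
  obtain a b c d where k: "k = mat2 a b c d"
    by (rule mat2_cases)
  define D where "D = a * d - b * c"
  define k' where "k' = mat2 (inverse D * d) (- (inverse D * b)) (- (inverse D * c)) (inverse D * a)"
  have O: "a \<in> ring_O" "b \<in> ring_O" "c \<in> ring_O" "d \<in> ring_O"
    using assms by (simp_all add: k mat2_in_GL2_O)
  have D0: "D $$ 0 \<noteq> 0"
    using assms by (simp add: k GL2_O_def D_def)
  then have "D \<noteq> 0" by auto
  then have inv: "inverse D * (a * d - b * c) = 1"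
    by (simp add: D_def)
  have "inverse D \<in> ring_O"
    using D0 O by (intro ring_O_inverse) (auto simp: D_def intro!: ring_O_intros)
  then have k': "k' \<in> entries_in ring_O"
    using O by (auto simp: k'_def intro!: ring_O_intros)
  have "k ** k' = mat (inverse D * (a * d - b * c))"
    by (simp add: k'_def k mat_conv_mat2 algebra_simps)
  then have kk': "k ** k' = mat 1"
    by (simp only: inv)
  have "(\<lambda>w. k *v w) ` lattice_O2 = lattice_O2"
  proof
    show "(\<lambda>w. k *v w) ` lattice_O2 \<subseteq> lattice_O2"
      using assms entries_in_ring_O_vec unfolding GL2_O_def by blast
    have "w = k *v (k' *v w)" for w
      using kk' by (simp add: matrix_vector_mul_assoc)
    then show "lattice_O2 \<subseteq> (\<lambda>w. k *v w) ` lattice_O2"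
      using entries_in_ring_O_vec[OF k'] by blast
  qed
  then show ?thesis
    by (simp add: act_v0) (simp add: v0_def)
qed

text \<open>
  An inclusion of lattices is a divisibility of matrices: the columns of \<open>k\<close> are preimages of
  the images of the standard basis.
\<close>
lemma matrix_factor_of_lattice_subset:
  fixes A B :: "'a::field mat2"
  assumes "(\<lambda>w. A *v w) ` lattice_O2 \<subseteq> (\<lambda>w. B *v w) ` lattice_O2"
  obtains k where "k \<in> entries_in ring_O" "A = B ** k"
proof -
  have "\<exists>w\<in>lattice_O2. A *v axis i 1 = B *v w" for i
  proof -
    have "(axis i 1 :: 'a fls ^ 2) \<in> lattice_O2"
      by (auto simp: axis_def ring_O_intros)
    with assms show ?thesis by blast
  qed
  then obtain w where w: "w i \<in> lattice_O2" "A *v axis i 1 = B *v w i" for i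
    by metis
  define k where "k = mat2 (w 1 $ 1) (w 2 $ 1) (w 1 $ 2) (w 2 $ 2)"
  obtain a b c d where A: "A = mat2 a b c d"
    by (rule mat2_cases)
  obtain a' b' c' d' where B: "B = mat2 a' b' c' d'"
    by (rule mat2_cases)
  have "A = B ** k"
    using w(2)[of 1] w(2)[of 2]
    by (simp add: A B k_def vec_eq_iff[of "_ *v _"] forall_2 mat2_mult_vec axis_def)
  moreover have "k \<in> entries_in ring_O"
    using w(1) by (simp add: k_def)
  ultimately show ?thesis using that by blast
qed

lemma mat_1_GL2_poly: "mat 1 \<in> (GL2_poly :: 'a::field mat2 set)"
  using GL2_poly_mult[OF swap_GL2_poly swap_GL2_poly] by (simp add: swap_swap)

text \<open>
  The determinant and its inverse are both polynomials, so both have nonnegative degree.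
\<close>
lemma GL2_poly_det_subdegree:
  assumes "\<gamma> \<in> GL2_poly"
  shows "det \<gamma> \<noteq> 0" "fls_subdegree (det \<gamma>) = 0"
proof -
  obtain \<delta> where \<delta>: "\<delta> \<in> GL2_poly" "\<gamma> ** \<delta> = mat 1"
    using assms by (rule GL2_poly_inverse)
  have d: "det \<gamma> * det \<delta> = 1"
    using \<delta>(2) by (metis det_I det_mul)
  then show nz: "det \<gamma> \<noteq> 0" by auto
  have "det \<eta> \<in> poly_ring_t" if "\<eta> \<in> GL2_poly" for \<eta> :: "'a mat2"
    using that unfolding GL2_poly_def
    by (cases \<eta> rule: mat2_cases)
      (simp add: diff_conv_add_uminus poly_ring_t_add poly_ring_t_mult poly_ring_t_uminus
        del: add_uminus_conv_diff)
  then have "fls_subdegree (det \<gamma>) \<le> 0" "fls_subdegree (det \<delta>) \<le> 0"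
    using assms \<delta>(1) poly_ring_t_subdegree by blast+
  moreover have "fls_subdegree (det \<gamma>) + fls_subdegree (det \<delta>) = 0"
    using d nz by (metis fls_one_subdegree fls_subdegree_mult mult_zero_right zero_neq_one)
  ultimately show "fls_subdegree (det \<gamma>) = 0" by simp
qed

text \<open>
  The second row of \<open>\<delta> ** abar n\<close> consists of polynomials that do not both vanish, and it is
  \<open>c\<close> times an integral row; hence \<open>c\<close> has nonnegative degree. Comparing determinants then
  gives the second inequality, because \<open>det \<delta>\<close> is a nonzero constant.
\<close>
lemma abar_comparison:
  fixes \<delta> :: "'a::field mat2"
  assumes \<delta>: "\<delta> \<in> GL2_poly" and k: "k \<in> entries_in ring_O" and c: "c \<noteq> 0"
    and eq: "\<delta> ** abar n = abar m ** mat c ** k"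
  shows "fls_subdegree c \<le> 0" "2 * fls_subdegree c \<le> int m - int n"
proof -
  obtain a b d e where \<delta>': "\<delta> = mat2 a b d e"
    by (rule mat2_cases)
  obtain a' b' d' e' where k': "k = mat2 a' b' d' e'"
    by (rule mat2_cases)
  have P: "d \<in> poly_ring_t" "e \<in> poly_ring_t"
    using \<delta> by (auto simp: GL2_poly_def \<delta>')
  have O: "d' \<in> ring_O" "e' \<in> ring_O"
    using k by (auto simp: k')
  have row: "d * tt ^ n = c * d'" "e = c * e'"
    using eq by (simp_all add: \<delta>' k' abar_def mat_conv_mat2)
  have "d \<noteq> 0 \<or> e \<noteq> 0"
    using GL2_poly_det_subdegree(1)[OF \<delta>] by (auto simp: \<delta>')
  then show "fls_subdegree c \<le> 0"
  proof
    assume "e \<noteq> 0"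
    then have "fls_subdegree e = fls_subdegree c + fls_subdegree e'"
      using row(2) c by auto
    then show ?thesis
      using poly_ring_t_subdegree[OF P(2)] O(2) by (simp add: ring_O_iff)
  next
    assume "d \<noteq> 0"
    moreover from this row(1) have "d' \<noteq> 0" by auto
    ultimately have "fls_subdegree d - int n = fls_subdegree c + fls_subdegree d'"
      using arg_cong[OF row(1), of fls_subdegree] c by simp
    then show ?thesis
      using poly_ring_t_subdegree[OF P(1)] O(1) by (simp add: ring_O_iff)
  qed
  have "det \<delta> * tt ^ n = tt ^ m * c ^ 2 * det k"
    using arg_cong[OF eq, of det]
    by (simp add: det_mul) (simp add: abar_def mat_conv_mat2 power2_eq_square)
  moreover from this have "det k \<noteq> 0"
    using GL2_poly_det_subdegree(1)[OF \<delta>] by auto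
  moreover have "fls_subdegree (det \<delta> * tt ^ n) = - int n"
    using GL2_poly_det_subdegree[OF \<delta>] by simp
  ultimately have "- int n = - int m + 2 * fls_subdegree c + fls_subdegree (det k)"
    using c by (simp add: power2_eq_square)
  moreover have "det k \<in> ring_O"
    using k by (simp add: k' ring_O_intros)
  ultimately show "2 * fls_subdegree c \<le> int m - int n"
    by (simp add: ring_O_iff)
qed

text \<open>
  The vertices \<open>v_n\<close> lie in distinct \<open>GL_2(F_q[t])\<close>-orbits. If \<open>v_n\<close> is a translate of
  \<open>v_m\<close>, their lattices are homothetic by some \<open>c\<close>, and the preceding comparison applies to
  \<open>c\<close> in one direction and to \<open>inverse c\<close> in the other; so \<open>c\<close> has degree 0, and then the two
  determinant inequalities force \<open>m = n\<close>.
\<close>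
lemma height_abar: "height (act (abar n) (v0 :: ('a::field fls ^ 2) set set)) = n"
  unfolding height_def
proof (rule the_equality)
  show "\<exists>\<gamma>\<in>GL2_poly. act (abar n) (v0 :: ('a::field fls ^ 2) set set) = act \<gamma> (act (abar n) v0)"
    by (intro bexI[of _ "mat 1"]) (simp_all add: act_one mat_1_GL2_poly)
next
  fix m assume "\<exists>\<gamma>\<in>GL2_poly. act (abar n) (v0 :: ('a fls ^ 2) set set) = act \<gamma> (act (abar m) v0)"
  then obtain \<gamma> :: "'a mat2" where \<gamma>: "\<gamma> \<in> GL2_poly" "act (abar n) v0 = act (\<gamma> ** abar m) v0"
    by (auto simp: act_mult)
  obtain \<delta> where \<delta>: "\<delta> \<in> GL2_poly" "\<gamma> ** \<delta> = mat 1" "\<delta> ** \<gamma> = mat 1"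
    using \<gamma>(1) by (rule GL2_poly_inverse)
  have "(\<lambda>w. (abar n :: 'a mat2) *v w) ` lattice_O2 \<in> act (abar n) v0"
    unfolding mem_act_v0_iff by (intro exI[of _ 1]) simp
  then have "(\<lambda>w. abar n *v w) ` lattice_O2 \<in> act (\<gamma> ** abar m) v0"
    using \<gamma>(2) by simp
  then obtain c where c: "c \<noteq> 0" and
    eq: "(\<lambda>w. abar n *v w) ` lattice_O2 = (\<lambda>w. (\<gamma> ** abar m ** mat c) *v w) ` lattice_O2"
    unfolding mem_act_v0_iff by blast
  obtain k where k: "k \<in> entries_in ring_O" "abar n = \<gamma> ** abar m ** mat c ** k"
    using matrix_factor_of_lattice_subset[of "abar n" "\<gamma> ** abar m ** mat c"] eq by blast
  obtain k' where k': "k' \<in> entries_in ring_O" "\<gamma> ** abar m ** mat c = abar n ** k'"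
    using matrix_factor_of_lattice_subset[of "\<gamma> ** abar m ** mat c" "abar n"] eq by blast
  have "\<delta> ** abar n = abar m ** mat c ** k"
    by (simp add: k(2) matrix_mul_assoc \<delta>(3))
  note 1 = abar_comparison[OF \<delta>(1) k(1) c this]
  have "\<gamma> ** abar m = \<gamma> ** abar m ** mat c ** mat (inverse c)"
    using c by (simp add: mat_mat flip: matrix_mul_assoc)
  also have "\<dots> = abar n ** mat (inverse c) ** k'"
    unfolding k'(2) by (simp add: mat_commute flip: matrix_mul_assoc)
  finally have "\<gamma> ** abar m = abar n ** mat (inverse c) ** k'" .
  note 2 = abar_comparison[OF \<gamma>(1) k'(1) _ this]
  from 1 2 c show "m = n" by simp
qed

section \<open>Reduction theory\<close>

text \<open>
  The double coset decomposition behind the statement that the quotient of the tree is a ray.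
  It is shown for all of \<open>GL_2(F)\<close> by checking that the decomposable matrices are closed under
  right multiplication by scalars, by \<open>GL_2(O)\<close> and by \<open>shrink\<close>, which together generate
  \<open>GL_2(F)\<close>. Only \<open>shrink\<close> changes \<open>n\<close>.
\<close>
definition reducible :: "'a::field mat2 \<Rightarrow> bool" where
  "reducible g \<longleftrightarrow>
     (\<exists>\<gamma>\<in>GL2_poly. \<exists>n. \<exists>k\<in>GL2_O. \<exists>c. c \<noteq> 0 \<and> g = \<gamma> ** abar n ** k ** mat c)"

lemma reducibleI:
  assumes "\<gamma> \<in> GL2_poly" "k \<in> GL2_O" "c \<noteq> 0" "g = \<gamma> ** abar n ** k ** mat c"
  shows "reducible g"
  using assms unfolding reducible_def by blast

lemma reducible_mat_1: "reducible (mat 1)"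
  by (rule reducibleI[OF mat_1_GL2_poly mat_1_GL2_O zero_neq_one[symmetric], of _ 0])
    (simp add: abar_0)

lemma reducible_mult_mat:
  assumes "reducible g" "c \<noteq> 0"
  shows "reducible (g ** mat c)"
proof -
  obtain \<gamma> n k d where *: "\<gamma> \<in> GL2_poly" "k \<in> GL2_O" "d \<noteq> 0" "g = \<gamma> ** abar n ** k ** mat d"
    using assms(1) unfolding reducible_def by blast
  have "d * c \<noteq> 0"
    using *(3) assms(2) by simp
  moreover have "g ** mat c = \<gamma> ** abar n ** k ** mat (d * c)"
    by (simp add: *(4) mat_mat flip: matrix_mul_assoc)
  ultimately show ?thesis
    by (rule reducibleI[OF *(1,2)])
qed

lemma reducible_mult_GL2_O:
  assumes "reducible g" "h \<in> GL2_O"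
  shows "reducible (g ** h)"
proof -
  obtain \<gamma> n k d where *: "\<gamma> \<in> GL2_poly" "k \<in> GL2_O" "d \<noteq> 0" "g = \<gamma> ** abar n ** k ** mat d"
    using assms(1) unfolding reducible_def by blast
  have "g ** h = \<gamma> ** abar n ** (k ** h) ** mat d"
    unfolding *(4) by (simp add: mat_commute flip: matrix_mul_assoc)
  with *(1,3) show ?thesis
    by (rule reducibleI[OF _ GL2_O_mult[OF *(2) assms(2)]])
qed

lemma abar_swap_shrink: "abar n ** swap ** shrink = abar (Suc n) ** swap ** mat fls_X"
  by (simp add: abar_def swap_def shrink_def mat_conv_mat2 mult.assoc mult.commute[of tt] X_tt)

lemma shrink_eq_swap_abar: "shrink = swap ** abar 1 ** swap ** mat fls_X"
  by (simp add: abar_def swap_def shrink_def mat_conv_mat2 X_tt)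

text \<open>
  The matrix \<open>swap ** shrink\<close> exchanges \<open>v_0\<close> with its neighbour on the far side of the edge
  fixed by the Iwahori subgroup, so it normalises that subgroup.
\<close>
lemma iwahori_swap_shrink:
  assumes "i \<in> iwahori"
  obtains i' where "i' \<in> iwahori" "i ** swap ** shrink = swap ** shrink ** i'"
proof -
  obtain a b c d where i: "i = mat2 a b c d"
    by (rule mat2_cases)
  define i' where "i' = mat2 d (tt * c) (b * fls_X) a"
  have "i' \<in> iwahori"
    using assms by (auto simp: i i'_def mat2_in_iwahori residue_mult ring_O_X
        intro: ring_O_intros tt_mult_ring_O)
  moreover have "i ** swap ** shrink = swap ** shrink ** i'"
    by (simp add: i i'_def swap_def shrink_def mult.commute X_tt)
  ultimately show ?thesis using that by blast
qed

text \<open>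
  A step in the quotient ray. Writing \<open>shrink = swap ** (swap ** shrink)\<close> and decomposing
  \<open>k ** swap\<close> by Bruhat, the Iwahori factor passes to the right of \<open>swap ** shrink\<close>. In the first
  case the step goes from height \<open>n\<close> to \<open>n + 1\<close>. In the second case \<open>unip b\<close> is absorbed on the
  left, where conjugation by \<open>abar n\<close> makes it polynomial, and the step goes from \<open>n\<close> to
  \<open>n - 1\<close>, or from 0 to 1.
\<close>
lemma reducible_mult_shrink:
  fixes g :: "'a::field mat2"
  assumes "reducible g"
  shows "reducible (g ** shrink)"
proof -
  obtain \<gamma> n k d where *: "\<gamma> \<in> GL2_poly" "k \<in> GL2_O" "d \<noteq> 0" "g = \<gamma> ** abar n ** k ** mat d"
    using assms unfolding reducible_def by blast
  define G where "G = \<gamma> ** abar n"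
  have "reducible (G ** (k ** swap) ** swap ** shrink)"
    using GL2_O_mult[OF *(2) swap_GL2_O]
  proof (cases rule: GL2_O_Bruhat)
    case 1
    obtain i' where i': "i' \<in> iwahori" "k ** swap ** swap ** shrink = swap ** shrink ** i'"
      using 1 by (rule iwahori_swap_shrink)
    have "G ** (k ** swap) ** swap ** shrink = \<gamma> ** (abar n ** swap ** shrink) ** i'"
      using i'(2) by (simp add: G_def matrix_mul_assoc) (simp flip: matrix_mul_assoc)
    also have "\<dots> = \<gamma> ** abar (Suc n) ** (swap ** i') ** mat fls_X"
      unfolding abar_swap_shrink by (simp add: mat_commute flip: matrix_mul_assoc)
    finally show ?thesis
      using i'(1) iwahori_subset
      by (intro reducibleI[OF *(1) GL2_O_mult[OF swap_GL2_O]]) auto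
  next
    case (2 b i)
    obtain i' where i': "i' \<in> iwahori" "i ** swap ** shrink = swap ** shrink ** i'"
      using 2(1) by (rule iwahori_swap_shrink)
    define \<gamma>' where "\<gamma>' = \<gamma> ** unip (tt ^ n * fls_const b)"
    have \<gamma>': "\<gamma>' \<in> GL2_poly"
      using *(1) poly_ring_t_monomial[of b n] unfolding \<gamma>'_def
      by (intro GL2_poly_mult unip_GL2_poly) (simp_all add: mult.commute)
    have "G ** (k ** swap) ** swap ** shrink = G ** unip (fls_const b) ** swap ** (i ** swap ** shrink)"
      unfolding 2(2) by (simp add: matrix_mul_assoc)
    also have "\<dots> = \<gamma>' ** abar n ** shrink ** i'"
      unfolding i'(2) by (simp add: G_def \<gamma>'_def swap_swap abar_unip flip: matrix_mul_assoc)
    also have "reducible \<dots>"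
    proof (cases n)
      case 0
      have "\<gamma>' ** abar n ** shrink ** i' = \<gamma>' ** swap ** abar 1 ** (swap ** i') ** mat fls_X"
        by (simp add: 0 abar_0 shrink_eq_swap_abar mat_commute flip: matrix_mul_assoc)
      with i'(1) iwahori_subset show ?thesis
        by (intro reducibleI[OF GL2_poly_mult[OF \<gamma>' swap_GL2_poly] GL2_O_mult[OF swap_GL2_O]]) auto
    next
      case (Suc m)
      have "\<gamma>' ** abar n ** shrink ** i' = \<gamma>' ** (abar n ** shrink) ** i' ** mat 1"
        by (simp add: matrix_mul_assoc)
      then have "\<gamma>' ** abar n ** shrink ** i' = \<gamma>' ** abar m ** i' ** mat 1"
        by (simp only: Suc abar_Suc_shrink)
      with \<gamma>' i'(1) iwahori_subset show ?thesis
        by (intro reducibleI[of \<gamma>' i' 1]) auto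
    qed
    finally show ?thesis .
  qed
  moreover have "G ** (k ** swap) ** swap ** shrink ** mat d = g ** shrink"
    by (simp add: *(4) G_def mat_commute swap_swap flip: matrix_mul_assoc)
  ultimately show ?thesis
    using reducible_mult_mat *(3) by metis
qed

lemma reducible_mult_abar:
  fixes g :: "'a::field mat2"
  assumes "reducible g"
  shows "reducible (g ** abar n)"
proof (induction n)
  case 0
  with assms show ?case by (simp add: abar_0)
next
  case (Suc n)
  have "(abar (Suc n) :: 'a mat2) = abar n ** swap ** shrink ** swap ** mat tt"
    by (simp add: abar_def swap_def shrink_def mat_conv_mat2 X_tt mult.commute)
  then have "g ** abar (Suc n) = g ** abar n ** swap ** shrink ** swap ** mat tt"
    by (simp only: matrix_mul_assoc)
  with Suc show ?case
    by (simp add: reducible_mult_mat reducible_mult_GL2_O reducible_mult_shrink swap_GL2_O)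
qed

lemma reducible_mult_shrink_power:
  fixes g :: "'a::field mat2"
  assumes "reducible g"
  shows "reducible (g ** mat2 (fls_X ^ n) 0 0 1)"
proof (induction n)
  case 0
  with assms show ?case by (simp flip: mat_conv_mat2)
next
  case (Suc n)
  have "(mat2 (fls_X ^ Suc n) 0 0 1 :: 'a mat2) = mat2 (fls_X ^ n) 0 0 1 ** shrink"
    by (simp add: shrink_def mult.commute)
  then have "g ** mat2 (fls_X ^ Suc n) 0 0 1 = g ** mat2 (fls_X ^ n) 0 0 1 ** shrink"
    by (simp only: matrix_mul_assoc)
  with Suc show ?case
    by (simp add: reducible_mult_shrink)
qed

text \<open>
  Conjugation by a high power of \<open>abar 1\<close> makes any unipotent matrix integral.
\<close>
lemma reducible_mult_unip:
  assumes "reducible g"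
  shows "reducible (g ** unip y)"
proof -
  define n where "n = nat (- fls_subdegree y)"
  define z where "z = fls_X ^ n * y"
  have "z \<in> ring_O"
    by (cases "y = 0") (auto simp: ring_O_iff z_def n_def)
  then have z: "unip z \<in> GL2_O"
    by (auto simp: unip_def mat2_in_GL2_O intro: ring_O_intros)
  have y: "unip y = abar n ** unip z ** mat2 (fls_X ^ n) 0 0 1"
    by (simp add: abar_def unip_def z_def tt_power_X_power) (metis tt_power_X_power mult.right_neutral)
  have "reducible (g ** abar n ** unip z ** mat2 (fls_X ^ n) 0 0 1)"
    using assms z by (intro reducible_mult_shrink_power reducible_mult_GL2_O reducible_mult_abar)
  then show ?thesis
    by (simp add: y matrix_mul_assoc)
qed

text \<open>
  Up to a power of \<open>t\<close>, the entry \<open>x\<close> is a unit of \<open>O\<close>.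
\<close>
lemma reducible_mult_diag:
  assumes "reducible g" "x \<noteq> 0"
  shows "reducible (g ** mat2 x 0 0 1)"
proof -
  define n where "n = nat (fls_subdegree x)"
  define m where "m = nat (- fls_subdegree x)"
  define u where "u = tt ^ n * fls_X ^ m * x"
  have u: "fls_subdegree u = 0" "u \<noteq> 0"
    using assms(2) by (auto simp: u_def n_def m_def)
  then have "u $$ 0 \<noteq> 0"
    by (metis nth_fls_subdegree_nonzero)
  with u have K: "mat2 u 0 0 1 \<in> GL2_O"
    by (auto simp: mat2_in_GL2_O ring_O_0 ring_O_1 ring_O_iff[of u])
  have "fls_X ^ n * tt ^ m * u = tt ^ n * (fls_X ^ n * (tt ^ m * (fls_X ^ m * x)))"
    by (simp only: u_def mult_ac)
  then have "x = fls_X ^ n * tt ^ m * u"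
    by (simp only: tt_power_X_power)
  then have "g ** mat2 x 0 0 1 = g ** abar m ** mat2 (fls_X ^ n) 0 0 1 ** mat2 u 0 0 1"
    by (simp add: abar_def mult.commute mult.left_commute flip: matrix_mul_assoc)
  with assms(1) K show ?thesis
    by (simp add: reducible_mult_shrink_power reducible_mult_GL2_O reducible_mult_abar)
qed

lemma reducible_of_det:
  fixes g :: "'a::field mat2"
  assumes "det g \<noteq> 0"
  shows "reducible g"
proof -
  have upper: "reducible (mat2 a b 0 d)" if "a \<noteq> 0" "d \<noteq> 0" for a b d :: "'a fls"
  proof -
    have "mat2 a b 0 d = mat 1 ** unip (b / d) ** mat2 (a / d) 0 0 1 ** mat d"
      using that by (simp add: unip_def mat_conv_mat2)
    also have "reducible \<dots>"
      using that by (intro reducible_mult_mat reducible_mult_diag reducible_mult_unip reducible_mat_1) auto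
    finally show ?thesis .
  qed
  obtain a b c d where g: "g = mat2 a b c d"
    by (rule mat2_cases)
  show ?thesis
  proof (cases "d = 0")
    case True
    then have "b \<noteq> 0" "c \<noteq> 0" "g = mat2 b a 0 c ** swap"
      using assms by (auto simp: g swap_def)
    with upper show ?thesis
      by (simp add: reducible_mult_GL2_O swap_GL2_O)
  next
    case False
    then have "(a * d - b * c) / d \<noteq> 0" "g = mat2 ((a * d - b * c) / d) b 0 d ** swap ** unip (c / d) ** swap"
      using assms by (auto simp: g swap_def unip_def field_simps)
    with False upper show ?thesis
      by (simp add: reducible_mult_GL2_O reducible_mult_unip swap_GL2_O del: mat2_mult)
  qed
qed

section \<open>Sums over the branch below a vertex\<close>

text \<open>
  The sum of \<open>\<Phi>\<close> over the heights of the \<open>q ^ N\<close> vertices at distance \<open>N\<close> from \<open>g v_0\<close>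
  that are reached by paths without backtracking whose first step does not go to \<open>g v_1\<close>. The matrix
  \<open>g ** unip c ** shrink\<close> represents the child of \<open>g v_0\<close> with label \<open>c\<close>, and the
  direction that it excludes in turn is the one back to \<open>g v_0\<close>.
\<close>
primrec branch_sum :: "(nat \<Rightarrow> complex) \<Rightarrow> nat \<Rightarrow> 'a::{finite,field} mat2 \<Rightarrow> complex" where
  "branch_sum \<Phi> 0 g = \<Phi> (height (act g v0))"
| "branch_sum \<Phi> (Suc N) g = (\<Sum>c\<in>UNIV. branch_sum \<Phi> N (g ** unip (fls_const c) ** shrink))"

lemma branch_sum_GL2_poly:
  assumes "\<gamma> \<in> GL2_poly"
  shows "branch_sum \<Phi> N (\<gamma> ** g) = branch_sum \<Phi> N g"
proof (induction N arbitrary: g)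
  case 0
  with assms show ?case by (simp add: act_mult height_act_GL2_poly)
next
  case (Suc N)
  then show ?case by (simp flip: matrix_mul_assoc)
qed

lemma branch_sum_mat:
  assumes "c \<noteq> 0"
  shows "branch_sum \<Phi> N (g ** mat c) = branch_sum \<Phi> N g"
proof (induction N arbitrary: g)
  case 0
  with assms show ?case by (simp add: act_mult act_mat_v0)
next
  case (Suc N)
  have "g ** mat c ** unip (fls_const b) ** shrink = g ** unip (fls_const b) ** shrink ** mat c" for b
    by (simp add: mat_commute flip: matrix_mul_assoc)
  with Suc show ?case by simp
qed

text \<open>
  On the labels of the children, an Iwahori matrix acts by its reduction modulo \<open>1/t\<close>, which is
  upper triangular, that is, by an affine bijection of \<open>F_q\<close>.
\<close>
lemma iwahori_permutes_children:
  fixes i :: "'a::{finite,field} mat2"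
  assumes "i \<in> iwahori"
  obtains f where "bij f"
    "\<And>c. \<exists>i'\<in>iwahori. i ** unip (fls_const c) ** shrink = unip (fls_const (f c)) ** shrink ** i'"
proof -
  obtain a b d e where i: "i = mat2 a b d e"
    by (rule mat2_cases)
  define f where "f c = (a $$ 0 * c + b $$ 0) / e $$ 0" for c
  have "inj f"
    using assms by (auto simp: inj_def f_def i mat2_in_iwahori)
  then have "bij f"
    by (simp add: bij_def finite_UNIV_inj_surj)
  moreover have "\<exists>i'\<in>iwahori. i ** unip (fls_const c) ** shrink = unip (fls_const (f c)) ** shrink ** i'" for c
  proof -
    \<comment> \<open>The label \<open>f c\<close> is the one for which \<open>y\<close> has residue 0, so that \<open>tt * y\<close> is integral.\<close>
    define y where "y = a * fls_const c + b - fls_const (f c) * (d * fls_const c + e)"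
    define i' where "i' = mat2 (a - fls_const (f c) * d) (tt * y) (d * fls_X) (d * fls_const c + e)"
    have O: "a \<in> ring_O" "b \<in> ring_O" "d \<in> ring_O" "e \<in> ring_O" "d $$ 0 = 0" "e $$ 0 \<noteq> 0" "a $$ 0 \<noteq> 0"
      using assms by (auto simp: i mat2_in_iwahori)
    have "y \<in> ring_O" "y $$ 0 = 0"
      using O by (auto simp: y_def residue_mult ring_O_intros f_def intro!: ring_O_intros)
    then have "tt * y \<in> ring_O"
      by (rule tt_mult_ring_O)
    then have "i' \<in> iwahori"
      using O by (auto simp: i'_def mat2_in_iwahori residue_mult ring_O_intros)
    moreover have "i ** unip (fls_const c) ** shrink = unip (fls_const (f c)) ** shrink ** i'"
      by (simp add: i i'_def unip_def shrink_def X_tt y_def algebra_simps)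
    ultimately show ?thesis by blast
  qed
  ultimately show ?thesis using that by blast
qed

lemma branch_sum_iwahori:
  fixes g :: "'a::{finite,field} mat2"
  assumes "i \<in> iwahori"
  shows "branch_sum \<Phi> N (g ** i) = branch_sum \<Phi> N g"
  using assms
proof (induction N arbitrary: g i)
  case 0
  then show ?case using iwahori_subset by (auto simp: act_mult act_GL2_O_v0)
next
  case (Suc N)
  obtain f where f: "bij f"
    "\<And>c. \<exists>i'\<in>iwahori. i ** unip (fls_const c) ** shrink = unip (fls_const (f c)) ** shrink ** i'"
    using Suc.prems by (rule iwahori_permutes_children) blast
  have "branch_sum \<Phi> N (g ** i ** unip (fls_const c) ** shrink)
      = branch_sum \<Phi> N (g ** unip (fls_const (f c)) ** shrink)" for c
  proof -
    obtain i' where i': "i' \<in> iwahori"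
      "i ** unip (fls_const c) ** shrink = unip (fls_const (f c)) ** shrink ** i'"
      using f(2) by blast
    have "g ** i ** unip (fls_const c) ** shrink = g ** (i ** unip (fls_const c) ** shrink)"
      by (simp add: matrix_mul_assoc)
    also have "\<dots> = g ** unip (fls_const (f c)) ** shrink ** i'"
      unfolding i'(2) by (simp add: matrix_mul_assoc)
    finally show ?thesis
      using Suc.IH[OF i'(1)] by simp
  qed
  then have "branch_sum \<Phi> (Suc N) (g ** i)
      = (\<Sum>c\<in>UNIV. branch_sum \<Phi> N (g ** unip (fls_const (f c)) ** shrink))"
    by simp
  also have "\<dots> = branch_sum \<Phi> (Suc N) g"
    using sum.reindex_bij_betw[OF f(1), of "\<lambda>c. branch_sum \<Phi> N (g ** unip (fls_const c) ** shrink)"]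
    by simp
  finally show ?case .
qed

lemma branch_sum_abar_unip:
  fixes A :: "'a::{finite,field} mat2"
  shows "branch_sum \<Phi> N (abar n ** unip (fls_const c) ** A) = branch_sum \<Phi> N (abar n ** A)"
proof -
  have "unip (tt ^ n * fls_const c) \<in> GL2_poly"
    using poly_ring_t_monomial[of c n] by (intro unip_GL2_poly) (simp add: mult.commute)
  then have "branch_sum \<Phi> N (unip (tt ^ n * fls_const c) ** (abar n ** A)) = branch_sum \<Phi> N (abar n ** A)"
    by (rule branch_sum_GL2_poly)
  then show ?thesis
    by (simp add: abar_unip matrix_mul_assoc)
qed

text \<open>
  From height \<open>n + 1\<close> with the upper neighbour excluded, all \<open>q\<close> steps go down to height \<open>n\<close>,
  where again the upper neighbour is excluded.
\<close>
lemma branch_sum_down: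
  "branch_sum \<Phi> (Suc N) (abar (Suc n) :: 'a::{finite,field} mat2) =
     of_nat CARD('a) * branch_sum \<Phi> N (abar n :: 'a mat2)"
  by (simp add: branch_sum_abar_unip abar_Suc_shrink)

lemma branch_sum_swap:
  "branch_sum \<Phi> N (swap ** A) = branch_sum \<Phi> N A"
  by (rule branch_sum_GL2_poly[OF swap_GL2_poly])

text \<open>
  At height 0 all neighbours have height 1, so after one step the excluded neighbour is the lower
  one; the factor \<open>swap\<close> records this, since \<open>abar n ** swap\<close> sends \<open>v_1\<close> to \<open>v_(n-1)\<close>.
\<close>
lemma branch_sum_turn:
  "branch_sum \<Phi> (Suc N) (mat 1 :: 'a::{finite,field} mat2) =
     of_nat CARD('a) * branch_sum \<Phi> N (abar 1 ** swap :: 'a mat2)"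
proof -
  have "branch_sum \<Phi> N (unip (fls_const c) ** shrink) = branch_sum \<Phi> N (abar 1 ** swap :: 'a mat2)" for c :: 'a
  proof -
    have "branch_sum \<Phi> N (unip (fls_const c) ** shrink) = branch_sum \<Phi> N (abar 0 ** unip (fls_const c) ** shrink)"
      by (simp add: abar_0)
    also have "\<dots> = branch_sum \<Phi> N (swap ** (abar 1 ** swap) ** mat fls_X :: 'a mat2)"
      unfolding branch_sum_abar_unip by (simp add: abar_0 shrink_eq_swap_abar matrix_mul_assoc)
    finally show ?thesis
      by (simp only: branch_sum_mat[OF fls_X_nonzero] branch_sum_swap)
  qed
  then show ?thesis by simp
qed

text \<open>
  With one lower neighbour excluded, the label \<open>c = 0\<close> leads to the upper neighbour and the
  \<open>q - 1\<close> nonzero labels lead to the other lower neighbours.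
\<close>
lemma branch_sum_up:
  "branch_sum \<Phi> (Suc N) (abar (Suc n) ** swap :: 'a::{finite,field} mat2) =
     branch_sum \<Phi> N (abar (Suc (Suc n)) ** swap :: 'a mat2) +
     (of_nat CARD('a) - 1) * branch_sum \<Phi> N (abar n :: 'a mat2)"
proof -
  define F where "F c = branch_sum \<Phi> N (abar (Suc n) ** swap ** unip (fls_const c) ** shrink)" for c :: 'a
  have "F 0 = branch_sum \<Phi> N (abar (Suc n) ** swap ** shrink :: 'a mat2)"
    by (simp add: F_def unip_def flip: mat_conv_mat2)
  then have F0: "F 0 = branch_sum \<Phi> N (abar (Suc (Suc n)) ** swap :: 'a mat2)"
    by (simp only: abar_swap_shrink branch_sum_mat[OF fls_X_nonzero])
  have F: "F c = branch_sum \<Phi> N (abar n :: 'a mat2)" if "c \<noteq> 0" for c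
  proof -
    \<comment> \<open>The product \<open>swap ** unip c\<close> is \<open>unip (1 / c)\<close> times a lower triangular matrix;
      conjugated by \<open>shrink\<close>, the latter becomes the Iwahori matrix \<open>i\<close>.\<close>
    define i where "i = mat2 (fls_const (- inverse c)) 0 fls_X (fls_const c)"
    have i: "i \<in> iwahori"
      using that by (auto simp: i_def mat2_in_iwahori ring_O_intros intro: ring_O_intros)
    have "unip (tt ^ Suc n * fls_const (inverse c)) \<in> GL2_poly"
      using poly_ring_t_monomial[of "inverse c" "Suc n"]
      by (intro unip_GL2_poly) (simp add: mult.commute)
    moreover have "abar (Suc n) ** swap ** unip (fls_const c) ** shrink =
        unip (tt ^ Suc n * fls_const (inverse c)) ** (abar n ** i)"
      using that
      by (simp add: abar_def swap_def unip_def shrink_def i_def X_tt mult.commute mult.left_commute)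
    ultimately show ?thesis
      by (simp add: F_def branch_sum_GL2_poly branch_sum_iwahori i)
  qed
  have "branch_sum \<Phi> (Suc N) (abar (Suc n) ** swap :: 'a mat2) = (\<Sum>c\<in>UNIV. F c)"
    by (simp add: F_def)
  also have "\<dots> = F 0 + (\<Sum>c\<in>UNIV - {0}. F c)"
    by (simp add: sum.remove)
  also have "(\<Sum>c\<in>UNIV - {0}. F c) = (\<Sum>c\<in>UNIV - {0 :: 'a}. branch_sum \<Phi> N (abar n :: 'a mat2))"
    by (rule sum.cong) (simp_all add: F)
  also have "\<dots> = (of_nat CARD('a) - 1) * branch_sum \<Phi> N (abar n :: 'a mat2)"
    by (simp add: of_nat_diff card_Diff_singleton Suc_leI)
  finally show ?thesis
    by (simp add: F0)
qed

text \<open>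
  For \<open>z \<ge> 0\<close> this is the mean of \<open>\<Phi>\<close> for the distribution obtained from \<open>\<rho>\<^sup>e\<^sup>v\<close> by moving
  all mass beyond \<open>2 * z\<close> to \<open>2 * z\<close>, written by Abel summation: \<open>\<rho>\<^sup>e\<^sup>v\<close> gives mass
  \<open>1 / q ^ (2 * i + 1)\<close> to the heights above \<open>2 * i\<close>. It is the distribution of the height after
  \<open>2 * z\<close> steps from height 0. A negative \<open>z\<close> stands for a descent that ends \<open>- 2 * z\<close> above
  height 0, so that only one value of \<open>\<Phi>\<close> occurs.
\<close>
definition truncated_mean :: "nat \<Rightarrow> (nat \<Rightarrow> complex) \<Rightarrow> int \<Rightarrow> complex" where
  "truncated_mean q \<Phi> z = \<Phi> (2 * nat (- z)) +
     (\<Sum>i<nat z. (\<Phi> (2 * Suc i) - \<Phi> (2 * i)) / of_nat q ^ (2 * i + 1))"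

lemma truncated_mean_diff_nonneg:
  "truncated_mean q \<Phi> (int r + 1) - truncated_mean q \<Phi> (int r) =
     (\<Phi> (2 * Suc r) - \<Phi> (2 * r)) / of_nat q ^ (2 * r + 1)"
proof -
  have "nat (int r + 1) = Suc r" by simp
  then show ?thesis
    by (simp add: truncated_mean_def)
qed

lemma truncated_mean_diff_neg:
  "truncated_mean q \<Phi> (- int r) - truncated_mean q \<Phi> (- int (Suc r)) = \<Phi> (2 * r) - \<Phi> (2 * Suc r)"
proof -
  have "nat (- (- int r)) = r" "nat (- (- int (Suc r))) = Suc r" "nat (- int r) = 0" "nat (- int (Suc r)) = 0"
    by simp_all
  then show ?thesis
    unfolding truncated_mean_def by (simp only:) simp
qed

text \<open>
  The increments of \<open>truncated_mean\<close> at \<open>r\<close> and at \<open>- r - 1\<close> are proportional with opposite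
  signs, and the weights \<open>q ^ i\<close> are such that the terms cancel in pairs from the outside. This is the
  starting value, for branches of length 0, of the formula for ascending branches.
\<close>
lemma weighted_differences_cancel:
  assumes "q > 0"
  shows "(\<Sum>i<2 * r. of_nat q ^ i *
     (truncated_mean q \<Phi> (int i - int r + 1) - truncated_mean q \<Phi> (int i - int r))) = 0"
proof (induction r)
  case (Suc r)
  define \<Delta> where "\<Delta> z = truncated_mean q \<Phi> (z + 1) - truncated_mean q \<Phi> z" for z
  have peel: "(\<Sum>i<2 * Suc r. f i) = f 0 + (\<Sum>i<2 * r. f (Suc i)) + f (2 * r + 1)" for f :: "nat \<Rightarrow> complex"
    using sum.lessThan_Suc_shift[of f "Suc (2 * r)"] by simp
  have "(\<Sum>i<2 * Suc r. of_nat q ^ i * \<Delta> (int i - int (Suc r))) =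
    \<Delta> (- int (Suc r)) + (\<Sum>i<2 * r. of_nat q ^ Suc i * \<Delta> (int i - int r)) + of_nat q ^ (2 * r + 1) * \<Delta> (int r)"
    unfolding peel by simp
  also have "(\<Sum>i<2 * r. of_nat q ^ Suc i * \<Delta> (int i - int r)) = of_nat q * (\<Sum>i<2 * r. of_nat q ^ i * \<Delta> (int i - int r))"
    by (simp add: sum_distrib_left mult.assoc)
  also have "(\<Sum>i<2 * r. of_nat q ^ i * \<Delta> (int i - int r)) = 0"
    using Suc.IH by (simp add: \<Delta>_def algebra_simps)
  also have "\<Delta> (- int (Suc r)) = \<Phi> (2 * r) - \<Phi> (2 * Suc r)"
    using truncated_mean_diff_neg[of q \<Phi> r] by (simp add: \<Delta>_def)
  also have "\<Delta> (int r) = (\<Phi> (2 * Suc r) - \<Phi> (2 * r)) / of_nat q ^ (2 * r + 1)"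
    unfolding \<Delta>_def by (rule truncated_mean_diff_nonneg)
  finally have "(\<Sum>i<2 * Suc r. of_nat q ^ i * \<Delta> (int i - int (Suc r))) = 0"
    using assms by simp
  then show ?case
    unfolding \<Delta>_def .
qed simp

text \<open>
  The three recursions determine both families of branch sums. A branch that starts at height
  \<open>n\<close> by descending arrives at height 0 with \<open>2 * z = N - n\<close> steps left. For a branch that
  may ascend, the ansatz with the weighted increments turns the recursion
  \<open>U_n(N + 1) = U_(n+1)(N) + (q - 1) D_(n-1)(N)\<close> into a shift of the summation index: its new
  first term is the increment from \<open>z - 1\<close> to \<open>z\<close>.
\<close>
lemma branch_sum_closed_form:
  fixes \<Phi> :: "nat \<Rightarrow> complex"
  defines "q \<equiv> CARD('a::{finite,field})"
  assumes "int N = int n + 2 * z"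
  shows "branch_sum \<Phi> N (abar n :: 'a mat2) = of_nat q ^ N * truncated_mean q \<Phi> z"
    and "branch_sum \<Phi> N (abar n ** swap :: 'a mat2) = of_nat q ^ N * (truncated_mean q \<Phi> z +
      (\<Sum>i<n. of_nat q ^ i * (truncated_mean q \<Phi> (z + int i + 1) - truncated_mean q \<Phi> (z + int i))))"
proof -
  define T where "T = truncated_mean q \<Phi>"
  define E where "E n z = (\<Sum>i<n. of_nat q ^ i * (T (z + int i + 1) - T (z + int i)))" for n z
  have q: "q > 0"
    by (simp add: q_def)
  have E_Suc: "E (Suc n) (z - 1) = T z - T (z - 1) + of_nat q * E n z" for n z
    unfolding E_def sum.lessThan_Suc_shift sum_distrib_left
    by (simp add: algebra_simps)
  have "branch_sum \<Phi> N (abar n :: 'a mat2) = of_nat q ^ N * T z \<and>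
      branch_sum \<Phi> N (abar n ** swap :: 'a mat2) = of_nat q ^ N * (T z + E n z)"
    using assms(2)
  proof (induction N arbitrary: n z)
    case 0
    define r where "r = nat (- z)"
    have r: "z = - int r" "n = 2 * r"
      using 0 by (auto simp: r_def)
    have "E n z = 0"
      using weighted_differences_cancel[OF q, of \<Phi> r] by (simp add: E_def T_def r algebra_simps)
    moreover have "T z = \<Phi> n"
      by (simp add: T_def truncated_mean_def r)
    moreover have "act (abar n ** swap) v0 = act (abar n) (v0 :: ('a fls ^ 2) set set)"
      by (simp add: act_mult act_GL2_O_v0 swap_GL2_O)
    ultimately show ?case
      by (simp add: height_abar)
  next
    case (Suc N)
    show ?case
    proof (cases n)
      \<comment> \<open>Here \<open>E 1 (z - 1)\<close> is the single increment \<open>T z - T (z - 1)\<close>.\<close>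
      case 0
      have "branch_sum \<Phi> (Suc N) (mat 1 :: 'a mat2) = of_nat q * (of_nat q ^ N * (T (z - 1) + E 1 (z - 1)))"
        unfolding branch_sum_turn using Suc.IH[of 1 "z - 1"] Suc.prems by (simp add: 0 q_def)
      then have "branch_sum \<Phi> (Suc N) (mat 1 :: 'a mat2) = of_nat q ^ Suc N * T z"
        by (simp add: E_def)
      moreover have "branch_sum \<Phi> (Suc N) (swap :: 'a mat2) = branch_sum \<Phi> (Suc N) (mat 1 :: 'a mat2)"
        using branch_sum_swap[of \<Phi> "Suc N" "mat 1 :: 'a mat2"] by (simp only: matrix_mul_rid)
      ultimately show ?thesis
        by (simp add: 0 abar_0 E_def del: branch_sum.simps)
    next
      case (Suc m)
      have IH: "branch_sum \<Phi> N (abar m :: 'a mat2) = of_nat q ^ N * T z"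
        "branch_sum \<Phi> N (abar (Suc n) ** swap :: 'a mat2) = of_nat q ^ N * (T (z - 1) + E (Suc n) (z - 1))"
        using Suc.IH[of m z] Suc.IH[of "Suc n" "z - 1"] Suc.prems by (simp_all add: Suc)
      show ?thesis
        using IH unfolding Suc branch_sum_down branch_sum_up q_def[symmetric] E_Suc
        by (simp add: algebra_simps)
    qed
  qed
  then show "branch_sum \<Phi> N (abar n :: 'a mat2) = of_nat q ^ N * truncated_mean q \<Phi> z"
    and "branch_sum \<Phi> N (abar n ** swap :: 'a mat2) = of_nat q ^ N * (truncated_mean q \<Phi> z +
      (\<Sum>i<n. of_nat q ^ i * (truncated_mean q \<Phi> (z + int i + 1) - truncated_mean q \<Phi> (z + int i))))"
    by (simp_all add: T_def E_def)
qed

text \<open>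
  Left multiplication by \<open>GL_2(F_q[t])\<close> and right multiplication by scalars and Iwahori matrices
  leave branch sums unchanged, so by reduction and the Bruhat decomposition only two cases survive:
  the excluded neighbour of the vertex of height \<open>n\<close> is its upper neighbour or a lower one. The
  parity comes from the determinant.
\<close>
lemma branch_sum_normal_form:
  fixes g :: "'a::{finite,field} mat2"
  assumes "det g \<noteq> 0"
  obtains n where "height (act g v0) = n" "even (fls_subdegree (det g) + int n)"
    "(\<forall>\<Phi> N. branch_sum \<Phi> N g = branch_sum \<Phi> N (abar n :: 'a mat2)) \<or>
     (\<forall>\<Phi> N. branch_sum \<Phi> N g = branch_sum \<Phi> N (abar n ** swap :: 'a mat2))"
proof -
  obtain \<gamma> n k c where *: "\<gamma> \<in> GL2_poly" "k \<in> GL2_O" "c \<noteq> 0" "g = \<gamma> ** abar n ** k ** mat c"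
    using reducible_of_det[OF assms] unfolding reducible_def by blast
  have eq: "branch_sum \<Phi> N g = branch_sum \<Phi> N (abar n ** k)" for \<Phi> N
  proof -
    have "branch_sum \<Phi> N g = branch_sum \<Phi> N (\<gamma> ** (abar n ** k))"
      unfolding *(4) branch_sum_mat[OF *(3)] by (simp add: matrix_mul_assoc)
    then show ?thesis
      by (simp add: branch_sum_GL2_poly *(1))
  qed
  have "height (act g v0) = n"
    by (simp add: *(4) act_mult act_mat_v0 *(3) act_GL2_O_v0 *(2) height_act_GL2_poly *(1) height_abar)
  moreover have "even (fls_subdegree (det g) + int n)"
  proof -
    have "det k $$ 0 \<noteq> 0" "det k \<in> ring_O"
      using *(2) by (cases k rule: mat2_cases, auto simp: GL2_O_def intro!: ring_O_intros)+
    then have k: "det k \<noteq> 0" "fls_subdegree (det k) = 0"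
      using fls_subdegree_leI[of "det k" 0] by (auto simp: ring_O_iff)
    have "det g = det \<gamma> * tt ^ n * det k * (c * c)"
      by (simp add: *(4) det_mul) (simp add: abar_def mat_conv_mat2)
    then have "fls_subdegree (det g) = - int n + 2 * fls_subdegree c"
      using k GL2_poly_det_subdegree[OF *(1)] *(3) by simp
    then show ?thesis by simp
  qed
  moreover have "(\<forall>\<Phi> N. branch_sum \<Phi> N g = branch_sum \<Phi> N (abar n :: 'a mat2)) \<or>
     (\<forall>\<Phi> N. branch_sum \<Phi> N g = branch_sum \<Phi> N (abar n ** swap :: 'a mat2))"
    using *(2)
  proof (cases rule: GL2_O_Bruhat)
    case 1
    then show ?thesis by (simp add: eq branch_sum_iwahori)
  next
    case (2 b i)
    have "branch_sum \<Phi> N (abar n ** k) = branch_sum \<Phi> N (abar n ** swap :: 'a mat2)" for \<Phi> N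
    proof -
      have "branch_sum \<Phi> N (abar n ** k) = branch_sum \<Phi> N (abar n ** unip (fls_const b) ** (swap ** i))"
        by (simp add: 2 matrix_mul_assoc)
      also have "\<dots> = branch_sum \<Phi> N (abar n ** swap ** i)"
        unfolding branch_sum_abar_unip by (simp only: matrix_mul_assoc)
      finally show ?thesis
        by (simp only: branch_sum_iwahori[OF 2(1)])
    qed
    then show ?thesis by (simp add: eq)
  qed
  ultimately show ?thesis using that by blast
qed

section \<open>Horospherical averages\<close>

text \<open>
  The ball \<open>r + t ^ N O\<close>. In terms of coefficients, subdividing a ball into \<open>q\<close> smaller ones
  means prescribing one more coefficient.
\<close>
definition O_ball :: "nat \<Rightarrow> 'a::field fls \<Rightarrow> 'a fls set" where
  "O_ball N r = {s. \<forall>n < - int N. s $$ n = r $$ n}"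

lemma O_ball_conv_ring_O: "O_ball N r = (\<lambda>z. r + z) ` (\<lambda>z. tt ^ N * z) ` ring_O"
proof (intro equalityI subsetI)
  fix s assume s: "s \<in> O_ball N r"
  have "fls_X ^ N * (s - r) \<in> ring_O"
    using s by (auto simp: ring_O_nth fls_X_power_times_conv_shift O_ball_def)
  moreover have "s = r + tt ^ N * (fls_X ^ N * (s - r))"
    by (simp add: tt_power_X_power)
  ultimately show "s \<in> (\<lambda>z. r + z) ` (\<lambda>z. tt ^ N * z) ` ring_O"
    by blast
qed (auto simp: O_ball_def ring_O_nth fls_X_inv_power_times_conv_shift)

lemma O_ball_Suc: "O_ball (Suc N) r = (\<Union>c. O_ball N (r + fls_const c * tt ^ Suc N))"
proof (intro equalityI subsetI)
  fix s assume s: "s \<in> O_ball (Suc N) r"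
  define c where "c = s $$ (- int (Suc N)) - r $$ (- int (Suc N))"
  have "s \<in> O_ball N (r + fls_const c * tt ^ Suc N)"
    unfolding O_ball_def
  proof (intro CollectI allI impI)
    fix n assume "n < - int N"
    then consider "n = - int (Suc N)" | "n < - int (Suc N)" by force
    then show "s $$ n = (r + fls_const c * tt ^ Suc N) $$ n"
      using s by cases (auto simp: O_ball_def c_def simp del: power_Suc)
  qed
  then show "s \<in> (\<Union>c. O_ball N (r + fls_const c * tt ^ Suc N))"
    by blast
qed (auto simp: O_ball_def simp del: power_Suc)

lemma O_ball_disjoint: "disjoint_family (\<lambda>c. O_ball N (r + fls_const c * tt ^ Suc N))"
proof -
  have "c = d" if "s \<in> O_ball N (r + fls_const c * tt ^ Suc N)" "s \<in> O_ball N (r + fls_const d * tt ^ Suc N)" for s c d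
    using that[unfolded O_ball_def, THEN CollectD, THEN spec[of _ "- int (Suc N)"]]
    by (simp del: power_Suc)
  then show ?thesis
    unfolding disjoint_family_on_def by blast
qed

text \<open>
  A set that is not measurable has measure 0 by convention, so \<open>\<mu>(O) = 1\<close> already makes \<open>O\<close>
  and its translates measurable.
\<close>
lemma normalized_haar_coset:
  assumes "normalized_haar \<mu>"
  shows "(\<lambda>z. r + z) ` ring_O \<in> sets \<mu>" "emeasure \<mu> ((\<lambda>z. r + z) ` ring_O) = 1"
proof -
  have "ring_O \<in> sets \<mu>"
    using assms emeasure_notin_sets[of ring_O \<mu>] by (auto simp: normalized_haar_def)
  then show *: "emeasure \<mu> ((\<lambda>z. r + z) ` ring_O) = 1"
    using assms by (auto simp: normalized_haar_def)
  then show "(\<lambda>z. r + z) ` ring_O \<in> sets \<mu>"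
    using emeasure_notin_sets[of "(\<lambda>z. r + z) ` ring_O" \<mu>] by auto
qed

lemma unip_add: "unip (r + s) = unip r ** unip s"
  by (simp add: unip_def)

text \<open>
  The subdivision of a ball matches the branching of the tree: \<open>unip r ** abar N\<close> stands for the
  ball \<open>r + t ^ N O\<close>, its \<open>q\<close> children for the subballs, and on a ball with
  \<open>N = 0\<close> the integrand is constant because \<open>unip z\<close> fixes \<open>v_0\<close> for \<open>z\<close> in \<open>O\<close>.
\<close>
lemma has_integral_O_ball:
  fixes \<mu> :: "'a::{finite,field} fls measure"
  assumes "normalized_haar \<mu>"
  shows "has_bochner_integral \<mu>
    (\<lambda>s. indicator (O_ball N r) s *\<^sub>R \<Phi> (height (act (g ** unip s) v0)))
    (branch_sum \<Phi> N (g ** unip r ** abar N))"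
proof (induction N arbitrary: r)
  case 0
  define y where "y = \<Phi> (height (act (g ** unip r) v0))"
  have "O_ball 0 r = (\<lambda>z. r + z) ` ring_O"
    by (simp add: O_ball_conv_ring_O image_image)
  then have ball: "O_ball 0 r \<in> sets \<mu>" "emeasure \<mu> (O_ball 0 r) = 1"
    using normalized_haar_coset[OF assms] by simp_all
  have "has_bochner_integral \<mu> (\<lambda>s. indicator (O_ball 0 r) s *\<^sub>R y) (measure \<mu> (O_ball 0 r) *\<^sub>R y)"
    using ball by (intro has_bochner_integral_indicator) simp_all
  moreover have "measure \<mu> (O_ball 0 r) = 1"
    using ball(2) by (simp add: measure_def)
  moreover have "\<Phi> (height (act (g ** unip s) v0)) = y" if s: "s \<in> O_ball 0 r" for s
  proof -
    obtain z where z: "z \<in> ring_O" "s = r + z"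
      using s by (auto simp: O_ball_conv_ring_O)
    have "unip z \<in> GL2_O"
      using z(1) by (simp add: unip_def mat2_in_GL2_O ring_O_intros)
    then show ?thesis
      by (simp add: z(2) y_def unip_add act_mult act_GL2_O_v0)
  qed
  then have "(\<lambda>s. indicator (O_ball 0 r) s *\<^sub>R y)
      = (\<lambda>s. indicator (O_ball 0 r) s *\<^sub>R \<Phi> (height (act (g ** unip s) v0)))"
    by (auto simp: indicator_def fun_eq_iff)
  ultimately show ?case
    by (simp add: y_def abar_0)
next
  case (Suc N)
  define B where "B c = O_ball N (r + fls_const c * tt ^ Suc N)" for c
  define F where "F s = \<Phi> (height (act (g ** unip s) v0))" for s
  have "indicator (O_ball (Suc N) r) s *\<^sub>R F s = (\<Sum>c\<in>UNIV. indicator (B c) s *\<^sub>R F s)" for s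
  proof -
    have "disjoint_family B"
      unfolding B_def by (rule O_ball_disjoint)
    then have "(indicator (\<Union>c. B c) s :: real) = (\<Sum>c\<in>UNIV. indicator (B c) s)"
      by (intro indicator_UN_disjoint) simp_all
    then show ?thesis
      unfolding O_ball_Suc B_def[symmetric] by (simp add: scaleR_left.sum)
  qed
  moreover have "has_bochner_integral \<mu> (\<lambda>s. \<Sum>c\<in>UNIV. indicator (B c) s *\<^sub>R F s)
      (\<Sum>c\<in>UNIV. branch_sum \<Phi> N (g ** unip (r + fls_const c * tt ^ Suc N) ** abar N))"
    unfolding B_def F_def by (intro has_bochner_integral_sum Suc.IH)
  moreover have "g ** unip (r + fls_const c * tt ^ Suc N) ** abar N =
      g ** unip r ** abar (Suc N) ** unip (fls_const c) ** shrink" for c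
  proof -
    have "abar (Suc N) ** unip (fls_const c) ** shrink =
        unip (tt ^ Suc N * fls_const c) ** (abar (Suc N) ** shrink)"
      unfolding abar_unip by (simp only: matrix_mul_assoc)
    then have "abar (Suc N) ** (unip (fls_const c) ** shrink) = unip (fls_const c * tt ^ Suc N) ** abar N"
      by (simp only: abar_Suc_shrink matrix_mul_assoc mult.commute)
    then show ?thesis
      by (simp only: unip_add flip: matrix_mul_assoc)
  qed
  ultimately show ?case
    by (simp add: F_def)
qed

lemma lambda_den_eq_branch_sum:
  fixes g :: "'a::{finite,field} mat2"
  assumes "normalized_haar \<mu>"
  shows "lambda_den \<mu> (coset g) N (\<Phi> \<circ> height_K) =
    branch_sum \<Phi> N (g ** abar N) / of_nat (CARD('a) ^ N)"
proof -
  have "(O_ball N 0 :: 'a fls set) = (\<lambda>z. tt ^ N * z) ` ring_O"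
    by (simp add: O_ball_conv_ring_O image_image)
  moreover have "unip 0 = (mat 1 :: 'a mat2)"
    by (simp add: unip_def mat_conv_mat2)
  ultimately have "(LINT s : (\<lambda>z. tt ^ N * z) ` ring_O | \<mu>. \<Phi> (height (act (g ** unip s) v0)))
      = branch_sum \<Phi> N (g ** abar N)"
    using has_bochner_integral_integral_eq[OF has_integral_O_ball[OF assms, of N 0 \<Phi> g]]
    by (simp add: set_lebesgue_integral_def)
  then show ?thesis
    by (simp add: lambda_den_def right_mult_coset height_K_coset)
qed

lemma lambda_den_formula:
  fixes \<mu> :: "'a::{finite,field} fls measure" and N :: nat
  assumes "normalized_haar \<mu>" "x \<in> space_X"
  defines "q \<equiv> CARD('a)" and "k \<equiv> k_index x N"
  obtains z where "M_index x N = 2 * z"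
    "(\<forall>\<Phi>. lambda_den \<mu> x N (\<Phi> \<circ> height_K) = truncated_mean q \<Phi> z) \<or>
     (\<forall>\<Phi>. lambda_den \<mu> x N (\<Phi> \<circ> height_K) = truncated_mean q \<Phi> z +
       (\<Sum>i<k. of_nat q ^ i * (truncated_mean q \<Phi> (z + int i + 1) - truncated_mean q \<Phi> (z + int i))))"
proof -
  obtain g where g: "x = coset g" "det g = 1"
    using assms(2) by (auto simp: space_X_def SL2_F_def)
  have det: "det (g ** abar N) = tt ^ N"
    by (simp add: det_mul g(2)) (simp add: abar_def)
  then have "det (g ** abar N) \<noteq> 0" by simp
  then obtain n where n: "height (act (g ** abar N) v0) = n"
    "even (fls_subdegree (det (g ** abar N)) + int n)"
    "(\<forall>\<Phi> L. branch_sum \<Phi> L (g ** abar N) = branch_sum \<Phi> L (abar n :: 'a mat2)) \<or>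
     (\<forall>\<Phi> L. branch_sum \<Phi> L (g ** abar N) = branch_sum \<Phi> L (abar n ** swap :: 'a mat2))"
    by (rule branch_sum_normal_form)
  have k: "k = n"
    by (simp add: k_def g(1) k_index_coset n(1))
  have "even (int N - int n)"
    using n(2) det by simp
  then obtain z where z: "int N - int n = 2 * z" by (rule evenE)
  then have N: "int N = int n + 2 * z" by simp
  have "M_index x N = 2 * z"
    using z k by (simp add: M_index_def k_def)
  then show ?thesis
    using n(3) branch_sum_closed_form[OF N, where 'a='a]
    by (intro that[of z]) (auto simp: g(1) lambda_den_eq_branch_sum[OF assms(1)] k q_def)
qed

section \<open>The limiting mean and the rate of convergence\<close>

text \<open>
  Summation by parts; the last term is the part of the mass at \<open>2 * n\<close> that \<open>\<rho>\<^sup>e\<^sup>v\<close> places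
  beyond \<open>2 * n\<close>. Letting \<open>n\<close> grow identifies \<open>mean_ev\<close> with the limit of the truncated
  means.
\<close>
lemma sum_rho_ev:
  assumes "q > 0"
  shows "(\<Sum>m<Suc n. \<Phi> (2 * m) * of_real (rho_ev q (2 * m))) =
    truncated_mean q \<Phi> (int n) - \<Phi> (2 * n) / of_nat q ^ (2 * n + 1)"
proof (induction n)
  case 0
  with assms show ?case
    by (simp add: truncated_mean_def rho_ev_def field_simps)
next
  case (Suc n)
  have T: "truncated_mean q \<Phi> (int (Suc n)) =
      truncated_mean q \<Phi> (int n) + (\<Phi> (2 * Suc n) - \<Phi> (2 * n)) / of_nat q ^ (2 * n + 1)"
    using truncated_mean_diff_nonneg[of q \<Phi> n] by (simp add: algebra_simps)
  show ?case
    unfolding sum.lessThan_Suc[of _ "Suc n"] Suc.IH T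
    using assms by (simp add: rho_ev_def field_simps power2_eq_square)
qed

locale growth =
  fixes q :: nat and \<alpha> C :: real and \<Phi> :: "nat \<Rightarrow> complex"
  assumes q: "q \<ge> 2" and \<alpha>: "\<alpha> < 2" and C: "C > 0" and bound: "growth_bound q \<alpha> C \<Phi>"
begin

abbreviation "T \<equiv> truncated_mean q \<Phi>"
definition "ratio = real q powr (\<alpha> - 2)"
definition "amplitude = C * ((1 + real q powr \<alpha>) / real q)"

lemma ratio: "0 < ratio" "ratio < 1"
  using q \<alpha> by (simp_all add: ratio_def powr_less_one)

lemma \<Phi>_weighted_bound: "norm (\<Phi> (2 * m) / of_nat q ^ (2 * m + 1)) \<le> C / q * ratio ^ m"
proof -
  have "norm (\<Phi> (2 * m)) / real q ^ (2 * m + 1) \<le> C * real q powr (\<alpha> * m) / real q ^ (2 * m + 1)"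
    using bound by (intro divide_right_mono) (auto simp: growth_bound_def)
  also have "\<dots> = C / q * (real q powr (\<alpha> * m) / real q powr (2 * m))"
    using q by (simp add: powr_realpow flip: powr_realpow)
  also have "real q powr (\<alpha> * m) / real q powr (2 * m) = ratio ^ m"
    using q by (simp add: ratio_def powr_realpow[symmetric] powr_powr left_diff_distrib flip: powr_diff)
  finally show ?thesis
    by (simp add: norm_divide norm_mult norm_power)
qed

lemma T_step_bound: "norm (T (int r + 1) - T (int r)) \<le> amplitude * ratio ^ r"
proof -
  have "norm (\<Phi> (2 * Suc r) - \<Phi> (2 * r)) \<le> C * real q powr (\<alpha> * Suc r) + C * real q powr (\<alpha> * r)"
    using bound unfolding growth_bound_def by (meson add_mono norm_triangle_ineq4 order_trans)
  also have "\<dots> = C * (1 + real q powr \<alpha>) * real q powr (\<alpha> * r)"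
    using q by (simp add: algebra_simps powr_add)
  finally have "norm (T (int r + 1) - T (int r)) \<le>
      C * (1 + real q powr \<alpha>) * real q powr (\<alpha> * r) / real q ^ (2 * r + 1)"
    unfolding truncated_mean_diff_nonneg by (simp add: norm_divide norm_mult norm_power divide_right_mono)
  also have "\<dots> = amplitude * (real q powr (\<alpha> * r) / real q powr (2 * r))"
    using q by (simp add: amplitude_def powr_realpow flip: powr_realpow)
  also have "real q powr (\<alpha> * r) / real q powr (2 * r) = ratio ^ r"
    using q by (simp add: ratio_def powr_realpow[symmetric] powr_powr left_diff_distrib flip: powr_diff)
  finally show ?thesis .
qed

text \<open>
  The increments of \<open>T\<close> are dominated by a geometric series, so \<open>T\<close> converges at the rate of its
  tail. The limit is \<open>mean_ev\<close> because the boundary terms of the summation by parts tend to 0. Both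
  steps rest on \<open>\<alpha> < 2\<close>.
\<close>
lemma T_mean: "norm (T (int r) - mean_ev q \<Phi>) \<le> amplitude * ratio ^ r / (1 - ratio)"
proof -
  define d where "d i = T (int i + 1) - T (int i)" for i
  have T: "T (int n) = T 0 + (\<Sum>i<n. d i)" for n
    by (induction n) (simp_all add: d_def add.commute)
  have geo: "summable (\<lambda>i. amplitude * ratio ^ i)"
    using ratio by (intro summable_mult summable_geometric) simp
  have d: "summable d"
    using T_step_bound by (intro summable_comparison_test'[OF geo, of 0]) (simp add: d_def)
  have lim: "(\<lambda>n. T (int n)) \<longlonglongrightarrow> T 0 + suminf d"
    unfolding T by (intro tendsto_intros summable_LIMSEQ d)
  have "(\<lambda>n. C / q * ratio ^ n) \<longlonglongrightarrow> 0"
    using ratio by (intro tendsto_mult_right_zero LIMSEQ_realpow_zero) auto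
  then have "(\<lambda>n. \<Phi> (2 * n) / of_nat q ^ (2 * n + 1)) \<longlonglongrightarrow> 0"
    by (rule Lim_null_comparison[rotated]) (intro always_eventually allI \<Phi>_weighted_bound)
  with lim have "(\<lambda>n. T (int n) - \<Phi> (2 * n) / of_nat q ^ (2 * n + 1)) \<longlonglongrightarrow> T 0 + suminf d - 0"
    by (intro tendsto_diff)
  then have "(\<lambda>n. \<Sum>m<Suc n. \<Phi> (2 * m) * of_real (rho_ev q (2 * m))) \<longlonglongrightarrow> T 0 + suminf d"
    using q by (subst sum_rho_ev) auto
  then have "(\<lambda>m. \<Phi> (2 * m) * of_real (rho_ev q (2 * m))) sums (T 0 + suminf d)"
    unfolding sums_def by (rule LIMSEQ_imp_Suc)
  then have mean: "mean_ev q \<Phi> = T 0 + suminf d"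
    unfolding mean_ev_def by (rule sums_unique[symmetric])
  have "norm (T (int r) - mean_ev q \<Phi>) = norm (\<Sum>i. d (i + r))"
    unfolding mean T using suminf_split_initial_segment[OF d, of r] by (simp add: norm_minus_commute)
  also have "\<dots> \<le> (\<Sum>i. amplitude * ratio ^ r * ratio ^ i)"
  proof (rule norm_suminf_le)
    show "summable (\<lambda>i. amplitude * ratio ^ r * ratio ^ i)"
      using ratio by (intro summable_mult summable_geometric) simp
    show "norm (d (i + r)) \<le> amplitude * ratio ^ r * ratio ^ i" for i
      using T_step_bound[of "i + r"] by (simp add: d_def power_add mult_ac)
  qed
  also have "\<dots> = amplitude * ratio ^ r / (1 - ratio)"
    using ratio by (subst suminf_mult) (auto intro!: summable_geometric simp: suminf_geometric)
  finally show ?thesis .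
qed

text \<open>
  The weight \<open>q ^ i\<close> raises the ratio of the series from \<open>q powr (\<alpha> - 2)\<close> to
  \<open>q powr (\<alpha> - 1)\<close>. The size of this ratio compared with 1 is what separates the three
  regimes.
\<close>
lemma excess_bound:
  "norm (\<Sum>i<k. of_nat q ^ i * (T (int r + int i + 1) - T (int r + int i)))
    \<le> amplitude * ratio ^ r * (\<Sum>i<k. (real q powr (\<alpha> - 1)) ^ i)"
proof -
  have "norm (of_nat q ^ i * (T (int r + int i + 1) - T (int r + int i)))
      \<le> amplitude * ratio ^ r * (real q powr (\<alpha> - 1)) ^ i" for i
  proof -
    have "norm (of_nat q ^ i * (T (int r + int i + 1) - T (int r + int i)))
        \<le> real q ^ i * (amplitude * ratio ^ (r + i))"
      using T_step_bound[of "r + i"] by (simp add: norm_mult norm_power mult_left_mono)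
    also have "\<dots> = amplitude * ratio ^ r * (real q * ratio) ^ i"
      by (simp add: power_add power_mult_distrib)
    also have "real q * ratio = real q powr (\<alpha> - 1)"
      using q by (simp add: ratio_def powr_diff power2_eq_square)
    finally show ?thesis .
  qed
  then show ?thesis
    unfolding sum_distrib_left by (rule sum_norm_le)
qed

end

section \<open>The three regimes\<close>

lemma CARD_field_ge_2: "CARD('a::{finite,field}) \<ge> 2"
  using card_mono[of UNIV "{0, 1 :: 'a}"] by simp

text \<open>
  The numerator comes from the triangle inequality for \<open>\<Phi> (2 * r + 2) - \<Phi> (2 * r)\<close>, the
  denominator from the odd exponent in \<open>1 / q ^ (2 * r + 1)\<close>.
\<close>
definition error_constant :: "nat \<Rightarrow> real \<Rightarrow> real" where
  "error_constant q \<alpha> = (1 + real q powr \<alpha>) / real q"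

text \<open>
  A single estimate for all \<open>\<alpha> < 2\<close>. With \<open>M = 2 * r\<close>, the first summand in the bracket
  accounts for the truncation at \<open>r\<close> and the geometric sum of length \<open>k\<close> for branches that first
  ascend from height \<open>k\<close>.
\<close>
lemma discrepancy_bound:
  fixes \<mu> :: "'a::{finite,field} fls measure" and N :: nat
  defines "q \<equiv> CARD('a)"
  assumes "normalized_haar \<mu>" "x \<in> space_X" "\<alpha> < 2" "C > 0" "growth_bound q \<alpha> C \<Phi>"
    and M: "M_index x N \<ge> 0"
  shows "discrepancy \<mu> x \<Phi> N \<le> error_constant q \<alpha> *
    (1 / (1 - real q powr (\<alpha> - 2)) + (\<Sum>i<k_index x N. (real q powr (\<alpha> - 1)) ^ i)) *
    (C * real q powr (- ((2 - \<alpha>) / 2) * real_of_int (M_index x N)))"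
proof -
  interpret growth q \<alpha> C \<Phi>
    by unfold_locales (fact CARD_field_ge_2[where 'a='a, folded q_def] assms)+
  define E where "E = (\<lambda>z. \<Sum>i<k_index x N. of_nat q ^ i * (T (z + int i + 1) - T (z + int i)))"
  obtain z where z: "M_index x N = 2 * z"
    "lambda_den \<mu> x N (\<Phi> \<circ> height_K) = T z \<or> lambda_den \<mu> x N (\<Phi> \<circ> height_K) = T z + E z"
    using lambda_den_formula[OF assms(2,3), of N, folded q_def] unfolding E_def by blast
  define r where "r = nat z"
  have r: "z = int r"
    using z(1) M by (simp add: r_def)
  have "norm (lambda_den \<mu> x N (\<Phi> \<circ> height_K) - mean_ev q \<Phi>) \<le> norm (T z - mean_ev q \<Phi>) + norm (E z)"
    using z(2) norm_triangle_ineq[of "T z - mean_ev q \<Phi>" "E z"] by (auto simp: algebra_simps)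
  also have "\<dots> \<le> amplitude * ratio ^ r / (1 - ratio)
      + amplitude * ratio ^ r * (\<Sum>i<k_index x N. (real q powr (\<alpha> - 1)) ^ i)"
    unfolding r E_def by (intro add_mono T_mean excess_bound)
  also have "\<dots> = amplitude * (1 / (1 - ratio) + (\<Sum>i<k_index x N. (real q powr (\<alpha> - 1)) ^ i)) * ratio ^ r"
    by (simp add: algebra_simps)
  also have "ratio ^ r = real q powr (- ((2 - \<alpha>) / 2) * real_of_int (M_index x N))"
  proof -
    have "(\<alpha> - 2) * real r = - ((2 - \<alpha>) / 2) * real_of_int (M_index x N)"
      by (simp add: z(1) r field_simps)
    then show ?thesis
      using q by (simp add: ratio_def powr_powr flip: powr_realpow)
  qed
  finally show ?thesis
    unfolding discrepancy_def q_def[symmetric] by (simp only: amplitude_def error_constant_def ratio_def mult_ac)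
qed

text \<open>
  The geometric sum is bounded, and \<open>(2 - \<alpha>) / 2 > 1 / 2\<close>.
\<close>
lemma discrepancy_bound_lt_1:
  fixes \<mu> :: "'a::{finite,field} fls measure"
  assumes q: "q = CARD('a)" and haar: "normalized_haar \<mu>" and \<alpha>: "\<alpha> < 1"
  shows "\<exists>C'. \<forall>x\<in>space_X. \<forall>\<Phi>. \<forall>C>0. growth_bound q \<alpha> C \<Phi> \<longrightarrow>
    (\<forall>N. M_index x N \<ge> 0 \<longrightarrow>
       discrepancy \<mu> x \<Phi> N \<le> C' * (C * real q powr (- real_of_int (M_index x N) / 2)))"
proof -
  have q2: "q \<ge> 2"
    using CARD_field_ge_2 q by simp
  define y where "y = real q powr (\<alpha> - 1)"
  define s where "s = 1 / (1 - real q powr (\<alpha> - 2))"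
  have y: "0 < y" "y < 1"
    using q2 \<alpha> by (simp_all add: y_def powr_less_one)
  have A: "error_constant q \<alpha> \<ge> 0"
    by (simp add: error_constant_def)
  have s: "s > 0"
    using q2 \<alpha> by (simp add: s_def powr_less_one)
  have "discrepancy \<mu> x \<Phi> N \<le> error_constant q \<alpha> * (s + 1 / (1 - y)) *
      (C * real q powr (- real_of_int (M_index x N) / 2))"
    if "x \<in> space_X" "C > 0" "growth_bound q \<alpha> C \<Phi>" and M: "M_index x N \<ge> 0" for x \<Phi> C N
  proof -
    have "discrepancy \<mu> x \<Phi> N \<le> error_constant q \<alpha> * (s + (\<Sum>i<k_index x N. y ^ i)) *
        (C * real q powr (- ((2 - \<alpha>) / 2) * real_of_int (M_index x N)))"
      using discrepancy_bound[OF haar that(1) _ that(2), of \<alpha> \<Phi> N] that \<alpha>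
      by (simp add: s_def y_def q)
    also have "\<dots> \<le> error_constant q \<alpha> * (s + 1 / (1 - y)) *
        (C * real q powr (- real_of_int (M_index x N) / 2))"
    proof (intro mult_mono mult_left_mono add_left_mono powr_mono)
      show "(\<Sum>i<k_index x N. y ^ i) \<le> 1 / (1 - y)"
        using sum_le_suminf[OF summable_geometric[of y], of "{..<k_index x N}"] y
        by (simp add: suminf_geometric)
      have "1 / 2 * real_of_int (M_index x N) \<le> (2 - \<alpha>) / 2 * real_of_int (M_index x N)"
        using \<alpha> M by (intro mult_right_mono) simp_all
      then show "- ((2 - \<alpha>) / 2) * real_of_int (M_index x N) \<le> - real_of_int (M_index x N) / 2"
        by simp
    qed (use A s y that q2 in \<open>auto intro!: add_nonneg_nonneg mult_nonneg_nonneg sum_nonneg\<close>)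
    finally show ?thesis .
  qed
  then show ?thesis by blast
qed

text \<open>
  The geometric sum equals \<open>k\<close>.
\<close>
lemma discrepancy_bound_eq_1:
  fixes \<mu> :: "'a::{finite,field} fls measure"
  assumes q: "q = CARD('a)" and haar: "normalized_haar \<mu>"
  shows "\<exists>C'. \<forall>x\<in>space_X. \<forall>\<Phi>. \<forall>C>0. growth_bound q 1 C \<Phi> \<longrightarrow>
    (\<forall>N. M_index x N \<ge> 0 \<longrightarrow>
       discrepancy \<mu> x \<Phi> N \<le>
         C' * (C * (real_of_int (M_index x N) + real (k_index x N) + 1) *
               real q powr (- real_of_int (M_index x N) / 2)))"
proof -
  have q2: "q \<ge> 2"
    using CARD_field_ge_2 q by simp
  define s where "s = 1 / (1 - real q powr (1 - 2))"
  have s: "s \<ge> 1"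
    using q2 by (simp add: s_def powr_minus field_simps)
  have A: "error_constant q 1 \<ge> 0"
    by (simp add: error_constant_def)
  have "discrepancy \<mu> x \<Phi> N \<le> error_constant q 1 * s *
      (C * (real_of_int (M_index x N) + real (k_index x N) + 1) *
       real q powr (- real_of_int (M_index x N) / 2))"
    if "x \<in> space_X" "C > 0" "growth_bound q 1 C \<Phi>" and M: "M_index x N \<ge> 0" for x \<Phi> C N
  proof -
    have "discrepancy \<mu> x \<Phi> N \<le> error_constant q 1 * (s + real (k_index x N)) *
        (C * real q powr (- real_of_int (M_index x N) / 2))"
      using discrepancy_bound[OF haar that(1) _ that(2), of 1 \<Phi> N] that q2
      by (simp add: s_def q)
    also have "\<dots> \<le> error_constant q 1 * (s * (real_of_int (M_index x N) + real (k_index x N) + 1)) *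
        (C * real q powr (- real_of_int (M_index x N) / 2))"
    proof (intro mult_right_mono mult_left_mono A)
      have "real (k_index x N) \<le> s * real (k_index x N)" "0 \<le> s * real_of_int (M_index x N)"
        using s M by (simp_all add: mult_le_cancel_right1)
      then show "s + real (k_index x N) \<le> s * (real_of_int (M_index x N) + real (k_index x N) + 1)"
        by (simp add: algebra_simps)
    qed (use that in simp)
    finally show ?thesis
      by (simp add: mult_ac)
  qed
  then show ?thesis by blast
qed

text \<open>
  The geometric sum is comparable to its last term \<open>q powr ((\<alpha> - 1) * k)\<close>.
\<close>
lemma discrepancy_bound_gt_1:
  fixes \<mu> :: "'a::{finite,field} fls measure"
  assumes q: "q = CARD('a)" and haar: "normalized_haar \<mu>" and \<alpha>: "1 < \<alpha>" "\<alpha> < 2"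
  shows "\<exists>C'. \<forall>x\<in>space_X. \<forall>\<Phi>. \<forall>C>0. growth_bound q \<alpha> C \<Phi> \<longrightarrow>
    (\<forall>N. M_index x N \<ge> 0 \<longrightarrow>
       discrepancy \<mu> x \<Phi> N \<le>
         C' * (C * real q powr (- ((2 - \<alpha>) / 2) * real_of_int (M_index x N)
                                + (\<alpha> - 1) * real (k_index x N))))"
proof -
  have q2: "q \<ge> 2"
    using CARD_field_ge_2 q by simp
  define y where "y = real q powr (\<alpha> - 1)"
  define s where "s = 1 / (1 - real q powr (\<alpha> - 2))"
  have y: "y > 1"
    using q2 \<alpha> by (simp add: y_def)
  have A: "error_constant q \<alpha> \<ge> 0"
    by (simp add: error_constant_def)
  have s: "s > 0"
    using q2 \<alpha> by (simp add: s_def powr_less_one)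
  have "discrepancy \<mu> x \<Phi> N \<le> error_constant q \<alpha> * (s + 1 / (y - 1)) *
      (C * real q powr (- ((2 - \<alpha>) / 2) * real_of_int (M_index x N) + (\<alpha> - 1) * real (k_index x N)))"
    if "x \<in> space_X" "C > 0" "growth_bound q \<alpha> C \<Phi>" and M: "M_index x N \<ge> 0" for x \<Phi> C N
  proof -
    have yk: "y ^ k_index x N = real q powr ((\<alpha> - 1) * real (k_index x N))"
      using q2 by (simp add: y_def powr_powr flip: powr_realpow)
    have "discrepancy \<mu> x \<Phi> N \<le> error_constant q \<alpha> * (s + (\<Sum>i<k_index x N. y ^ i)) *
        (C * real q powr (- ((2 - \<alpha>) / 2) * real_of_int (M_index x N)))"
      using discrepancy_bound[OF haar that(1) _ that(2), of \<alpha> \<Phi> N] that \<alpha>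
      by (simp add: s_def y_def q)
    also have "\<dots> \<le> error_constant q \<alpha> * ((s + 1 / (y - 1)) * y ^ k_index x N) *
        (C * real q powr (- ((2 - \<alpha>) / 2) * real_of_int (M_index x N)))"
    proof (intro mult_right_mono mult_left_mono A)
      have "1 \<le> y ^ k_index x N"
        using y by (intro one_le_power) simp
      then have "s \<le> s * y ^ k_index x N"
        using s by simp
      moreover have "(\<Sum>i<k_index x N. y ^ i) \<le> 1 / (y - 1) * y ^ k_index x N"
        using y by (simp add: geometric_sum divide_right_mono)
      ultimately show "s + (\<Sum>i<k_index x N. y ^ i) \<le> (s + 1 / (y - 1)) * y ^ k_index x N"
        by (simp add: algebra_simps)
    qed (use that in simp)
    finally show ?thesis
      unfolding yk powr_add by (simp add: mult_ac)
  qed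
  then show ?thesis by blast
qed

section \<open>Equidistribution\<close>

lemma lambda_den_tendsto:
  fixes \<mu> :: "'a::{finite,field} fls measure"
  assumes "q = CARD('a)"
    and bound: "\<And>N. M_index x N \<ge> 0 \<Longrightarrow> discrepancy \<mu> x \<Phi> N \<le> C' * (C * e N)"
    and M: "\<forall>\<^sub>F N in sequentially. M_index x N \<ge> 0"
    and e: "e \<longlonglongrightarrow> 0"
  shows "(\<lambda>N. lambda_den \<mu> x N (\<Phi> \<circ> height_K)) \<longlonglongrightarrow> mean_ev q \<Phi>"
proof -
  have "(\<lambda>N. C' * (C * e N)) \<longlonglongrightarrow> 0"
    using e by (intro tendsto_mult_right_zero)
  then have "(\<lambda>N. lambda_den \<mu> x N (\<Phi> \<circ> height_K) - mean_ev q \<Phi>) \<longlonglongrightarrow> 0"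
    by (rule Lim_null_comparison[rotated])
      (use M in eventually_elim, use bound assms(1) in \<open>simp add: discrepancy_def\<close>)
  then show ?thesis
    by (simp add: LIM_zero_iff)
qed

lemma powr_tendsto_0:
  fixes e :: "nat \<Rightarrow> real"
  assumes "q \<ge> 2" "filterlim e at_bot sequentially"
  shows "(\<lambda>N. real q powr e N) \<longlonglongrightarrow> 0"
proof -
  have "filterlim (\<lambda>N. ln (real q) * e N) at_bot sequentially"
    using assms by (intro filterlim_tendsto_pos_mult_at_bot[OF tendsto_const]) auto
  then have "(\<lambda>N. exp (ln (real q) * e N)) \<longlonglongrightarrow> 0"
    by (rule filterlim_compose[OF exp_at_bot])
  then show ?thesis
    using assms(1) by (simp add: powr_def mult.commute)
qed

text \<open>
  From \<open>N = M + k \<le> (1 + \<theta>) * M\<close>, the sequence \<open>M\<close> grows linearly in \<open>N\<close>, while the exponent is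
  at most \<open>- c * M\<close> with \<open>c = (2 - \<alpha>) / 2 - (\<alpha> - 1) * \<theta> > 0\<close>.
\<close>
lemma exponent_at_bot_of_sublinear:
  fixes M :: "nat \<Rightarrow> int" and k :: "nat \<Rightarrow> nat"
  assumes \<alpha>: "1 < \<alpha>" "\<alpha> < 2" and \<theta>: "\<theta> \<ge> 0" "\<theta> < (2 - \<alpha>) / (2 * (\<alpha> - 1))"
    and sum: "\<And>N. M N + int (k N) = int N"
    and le: "\<forall>\<^sub>F N in sequentially. real (k N) \<le> \<theta> * real_of_int (M N)"
  shows "filterlim (\<lambda>N. - ((2 - \<alpha>) / 2) * real_of_int (M N) + (\<alpha> - 1) * real (k N)) at_bot sequentially"
proof -
  define c where "c = (2 - \<alpha>) / 2 - (\<alpha> - 1) * \<theta>"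
  have c: "c > 0"
    using \<alpha> \<theta> by (simp add: c_def field_simps)
  have "filterlim (\<lambda>N. - (c / (1 + \<theta>) * real N)) at_bot sequentially"
    using c \<theta> unfolding filterlim_uminus_at_top[symmetric]
    by (intro filterlim_tendsto_pos_mult_at_top[OF tendsto_const _ filterlim_real_sequentially]) auto
  moreover have "\<forall>\<^sub>F N in sequentially.
      - ((2 - \<alpha>) / 2) * real_of_int (M N) + (\<alpha> - 1) * real (k N) \<le> - (c / (1 + \<theta>) * real N)"
    using le
  proof eventually_elim
    case (elim N)
    have "real N = real_of_int (M N) + real (k N)"
      using sum[of N] by (metis of_int_add of_int_of_nat_eq)
    then have "real N \<le> (1 + \<theta>) * real_of_int (M N)"
      using elim by (simp add: algebra_simps)
    then have "c / (1 + \<theta>) * real N \<le> c / (1 + \<theta>) * ((1 + \<theta>) * real_of_int (M N))"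
      using c \<theta> by (intro mult_left_mono) auto
    also have "\<dots> = c * real_of_int (M N)"
      using \<theta> by simp
    finally have "c / (1 + \<theta>) * real N \<le> c * real_of_int (M N)" .
    moreover have "(\<alpha> - 1) * real (k N) \<le> (\<alpha> - 1) * (\<theta> * real_of_int (M N))"
      using elim \<alpha> by (intro mult_left_mono) auto
    ultimately show ?case
      by (simp add: c_def algebra_simps)
  qed
  ultimately show ?thesis
    by (rule filterlim_at_bot_mono)
qed

text \<open>
  The estimates require \<open>M \<ge> 0\<close>. Each of the three hypotheses implies this for large \<open>N\<close>: in
  the second one a negative \<open>M\<close> would make both factors at least 1, and in the third one the
  \<open>k\<close>-term of the exponent is nonnegative.
\<close>
lemma equidistribution:
  fixes \<mu> :: "'a::{finite,field} fls measure"
  assumes q: "q = CARD('a)" and haar: "normalized_haar \<mu>"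
    and x: "x \<in> space_X" and C: "C > 0" and growth: "growth_bound q \<alpha> C \<Phi>"
  shows lambda_den_tendsto_lt_1:
    "\<alpha> < 1 \<Longrightarrow> filterlim (M_index x) at_top sequentially \<Longrightarrow>
      (\<lambda>N. lambda_den \<mu> x N (\<Phi> \<circ> height_K)) \<longlonglongrightarrow> mean_ev q \<Phi>"
    and lambda_den_tendsto_eq_1:
    "\<alpha> = 1 \<Longrightarrow> (\<lambda>N. (real_of_int (M_index x N) + real (k_index x N) + 1) *
        real q powr (- real_of_int (M_index x N) / 2)) \<longlonglongrightarrow> 0 \<Longrightarrow>
      (\<lambda>N. lambda_den \<mu> x N (\<Phi> \<circ> height_K)) \<longlonglongrightarrow> mean_ev q \<Phi>"
    and lambda_den_tendsto_gt_1:
    "1 < \<alpha> \<Longrightarrow> \<alpha> < 2 \<Longrightarrow> filterlim (\<lambda>N. - ((2 - \<alpha>) / 2) * real_of_int (M_index x N)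
        + (\<alpha> - 1) * real (k_index x N)) at_bot sequentially \<Longrightarrow>
      (\<lambda>N. lambda_den \<mu> x N (\<Phi> \<circ> height_K)) \<longlonglongrightarrow> mean_ev q \<Phi>"
proof -
  have q2: "q \<ge> 2"
    using CARD_field_ge_2 q by simp
  show "(\<lambda>N. lambda_den \<mu> x N (\<Phi> \<circ> height_K)) \<longlonglongrightarrow> mean_ev q \<Phi>"
    if \<alpha>: "\<alpha> < 1" and M: "filterlim (M_index x) at_top sequentially"
  proof -
    obtain C' where C': "\<And>N. M_index x N \<ge> 0 \<Longrightarrow>
        discrepancy \<mu> x \<Phi> N \<le> C' * (C * real q powr (- real_of_int (M_index x N) / 2))"
      using discrepancy_bound_lt_1[OF q haar \<alpha>] x C growth by blast
    have "filterlim (\<lambda>N. real_of_int (M_index x N)) at_top sequentially"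
      by (rule filterlim_compose[OF filterlim_real_of_int_at_top M])
    then have "filterlim (\<lambda>N. 1 / 2 * real_of_int (M_index x N)) at_top sequentially"
      by (intro filterlim_tendsto_pos_mult_at_top[OF tendsto_const]) auto
    then have "filterlim (\<lambda>N. - real_of_int (M_index x N) / 2) at_bot sequentially"
      by (simp add: filterlim_uminus_at_top)
    from lambda_den_tendsto[OF q C' _ powr_tendsto_0[OF q2 this]] show ?thesis
      using M by (auto simp: filterlim_at_top)
  qed
  show "(\<lambda>N. lambda_den \<mu> x N (\<Phi> \<circ> height_K)) \<longlonglongrightarrow> mean_ev q \<Phi>"
    if \<alpha>: "\<alpha> = 1" and e: "(\<lambda>N. (real_of_int (M_index x N) + real (k_index x N) + 1) *
        real q powr (- real_of_int (M_index x N) / 2)) \<longlonglongrightarrow> 0"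
  proof -
    obtain C' where C': "\<And>N. M_index x N \<ge> 0 \<Longrightarrow> discrepancy \<mu> x \<Phi> N \<le>
        C' * (C * ((real_of_int (M_index x N) + real (k_index x N) + 1) *
          real q powr (- real_of_int (M_index x N) / 2)))"
      using discrepancy_bound_eq_1[OF q haar] x C growth unfolding \<alpha> mult.assoc by blast
    have "\<forall>\<^sub>F N in sequentially. (real_of_int (M_index x N) + real (k_index x N) + 1) *
        real q powr (- real_of_int (M_index x N) / 2) < 1"
      using e by (rule order_tendstoD) simp
    then have "\<forall>\<^sub>F N in sequentially. M_index x N \<ge> 0"
    proof eventually_elim
      case (elim N)
      show ?case
      proof (rule ccontr)
        assume "\<not> M_index x N \<ge> 0"
        then have "1 \<le> real q powr (- real_of_int (M_index x N) / 2)"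
          using q2 by (intro ge_one_powr_ge_zero) auto
        moreover have "real_of_int (M_index x N) + real (k_index x N) + 1 \<ge> 1"
          by (simp add: M_index_def)
        ultimately have "1 * 1 \<le> (real_of_int (M_index x N) + real (k_index x N) + 1) *
            real q powr (- real_of_int (M_index x N) / 2)"
          by (intro mult_mono) auto
        with elim show False by simp
      qed
    qed
    from lambda_den_tendsto[OF q C' this e] show ?thesis by blast
  qed
  show "(\<lambda>N. lambda_den \<mu> x N (\<Phi> \<circ> height_K)) \<longlonglongrightarrow> mean_ev q \<Phi>"
    if \<alpha>: "1 < \<alpha>" "\<alpha> < 2" and e: "filterlim (\<lambda>N. - ((2 - \<alpha>) / 2) * real_of_int (M_index x N)
        + (\<alpha> - 1) * real (k_index x N)) at_bot sequentially"
  proof -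
    obtain C' where C': "\<And>N. M_index x N \<ge> 0 \<Longrightarrow> discrepancy \<mu> x \<Phi> N \<le>
        C' * (C * real q powr (- ((2 - \<alpha>) / 2) * real_of_int (M_index x N)
          + (\<alpha> - 1) * real (k_index x N)))"
      using discrepancy_bound_gt_1[OF q haar \<alpha>] x C growth by blast
    have "\<forall>\<^sub>F N in sequentially. - ((2 - \<alpha>) / 2) * real_of_int (M_index x N)
        + (\<alpha> - 1) * real (k_index x N) \<le> 0"
      using e unfolding filterlim_at_bot by (rule spec)
    then have "\<forall>\<^sub>F N in sequentially. M_index x N \<ge> 0"
    proof eventually_elim
      case (elim N)
      have "0 \<le> (\<alpha> - 1) * real (k_index x N)"
        using \<alpha> by simp
      with elim have "0 \<le> (2 - \<alpha>) / 2 * real_of_int (M_index x N)"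
        by simp
      with \<alpha> show ?case
        by (simp add: zero_le_mult_iff)
    qed
    from lambda_den_tendsto[OF q C' this powr_tendsto_0[OF q2 e]] show ?thesis by blast
  qed
qed

theorem theorem5p10:
  fixes \<mu> :: "'a::{finite,field} fls measure" and q :: nat
  assumes q: "q = CARD('a)"
    and haar: "normalized_haar \<mu>"
  shows
    "(\<forall>\<alpha><1. \<exists>C'. \<forall>x\<in>space_X. \<forall>\<Phi>. \<forall>C>0. growth_bound q \<alpha> C \<Phi> \<longrightarrow>
        (\<forall>N. M_index x N \<ge> 0 \<longrightarrow>
           discrepancy \<mu> x \<Phi> N \<le> C' * (C * real q powr (- real_of_int (M_index x N) / 2))))
     \<and>
     (\<exists>C'. \<forall>x\<in>space_X. \<forall>\<Phi>. \<forall>C>0. growth_bound q 1 C \<Phi> \<longrightarrow>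
        (\<forall>N. M_index x N \<ge> 0 \<longrightarrow>
           discrepancy \<mu> x \<Phi> N \<le>
             C' * (C * (real_of_int (M_index x N) + real (k_index x N) + 1) *
                   real q powr (- real_of_int (M_index x N) / 2))))
     \<and>
     (\<forall>\<alpha>. 1 < \<alpha> \<and> \<alpha> < 2 \<longrightarrow> (\<exists>C'. \<forall>x\<in>space_X. \<forall>\<Phi>. \<forall>C>0. growth_bound q \<alpha> C \<Phi> \<longrightarrow>
        (\<forall>N. M_index x N \<ge> 0 \<longrightarrow>
           discrepancy \<mu> x \<Phi> N \<le>
             C' * (C * real q powr (- ((2 - \<alpha>) / 2) * real_of_int (M_index x N)
                                    + (\<alpha> - 1) * real (k_index x N))))))
     \<and>
     (\<forall>x\<in>space_X. \<forall>\<Phi>. \<forall>C>0. \<forall>\<alpha><2. growth_bound q \<alpha> C \<Phi> \<longrightarrow>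
        (\<alpha> < 1 \<and> filterlim (M_index x) at_top sequentially \<longrightarrow>
           (\<lambda>N. lambda_den \<mu> x N (\<Phi> \<circ> height_K)) \<longlonglongrightarrow> mean_ev q \<Phi>)
        \<and>
        (\<alpha> = 1 \<and> (\<lambda>N. (real_of_int (M_index x N) + real (k_index x N) + 1) *
                        real q powr (- real_of_int (M_index x N) / 2)) \<longlonglongrightarrow> 0 \<longrightarrow>
           (\<lambda>N. lambda_den \<mu> x N (\<Phi> \<circ> height_K)) \<longlonglongrightarrow> mean_ev q \<Phi>)
        \<and>
        (1 < \<alpha> \<and> filterlim (\<lambda>N. - ((2 - \<alpha>) / 2) * real_of_int (M_index x N)
                                   + (\<alpha> - 1) * real (k_index x N)) at_bot sequentially \<longrightarrow>
           (\<lambda>N. lambda_den \<mu> x N (\<Phi> \<circ> height_K)) \<longlonglongrightarrow> mean_ev q \<Phi>)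
        \<and>
        (1 < \<alpha> \<and> (\<exists>\<theta>\<ge>0. \<theta> < (2 - \<alpha>) / (2 * (\<alpha> - 1)) \<and>
                     (\<forall>\<^sub>F N in sequentially.
                        real (k_index x N) \<le> \<theta> * real_of_int (M_index x N))) \<longrightarrow>
           (\<lambda>N. lambda_den \<mu> x N (\<Phi> \<circ> height_K)) \<longlonglongrightarrow> mean_ev q \<Phi>))"
proof (intro conjI allI ballI impI; (elim conjE exE)?)
  fix \<alpha> :: real assume "\<alpha> < 1"
  then show "\<exists>C'. \<forall>x\<in>space_X. \<forall>\<Phi>. \<forall>C>0. growth_bound q \<alpha> C \<Phi> \<longrightarrow>
        (\<forall>N. M_index x N \<ge> 0 \<longrightarrow>
           discrepancy \<mu> x \<Phi> N \<le> C' * (C * real q powr (- real_of_int (M_index x N) / 2)))"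
    by (rule discrepancy_bound_lt_1[OF q haar])
next
  show "\<exists>C'. \<forall>x\<in>space_X. \<forall>\<Phi>. \<forall>C>0. growth_bound q 1 C \<Phi> \<longrightarrow>
        (\<forall>N. M_index x N \<ge> 0 \<longrightarrow>
           discrepancy \<mu> x \<Phi> N \<le>
             C' * (C * (real_of_int (M_index x N) + real (k_index x N) + 1) *
                   real q powr (- real_of_int (M_index x N) / 2)))"
    by (rule discrepancy_bound_eq_1[OF q haar])
next
  fix \<alpha> :: real assume "1 < \<alpha>" "\<alpha> < 2"
  then show "\<exists>C'. \<forall>x\<in>space_X. \<forall>\<Phi>. \<forall>C>0. growth_bound q \<alpha> C \<Phi> \<longrightarrow>
        (\<forall>N. M_index x N \<ge> 0 \<longrightarrow>
           discrepancy \<mu> x \<Phi> N \<le>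
             C' * (C * real q powr (- ((2 - \<alpha>) / 2) * real_of_int (M_index x N)
                                    + (\<alpha> - 1) * real (k_index x N))))"
    by (rule discrepancy_bound_gt_1[OF q haar])
next
  fix x :: "'a mat2 set" and \<Phi> :: "nat \<Rightarrow> complex" and C \<alpha> :: real
  assume x: "x \<in> space_X" and C: "0 < C" and \<alpha>: "\<alpha> < 2" and growth: "growth_bound q \<alpha> C \<Phi>"
  let ?conv = "(\<lambda>N. lambda_den \<mu> x N (\<Phi> \<circ> height_K)) \<longlonglongrightarrow> mean_ev q \<Phi>"
  note conv = lambda_den_tendsto_lt_1[OF q haar x C growth] lambda_den_tendsto_eq_1[OF q haar x C growth]
    lambda_den_tendsto_gt_1[OF q haar x C growth _ \<alpha>]
  show ?conv if "\<alpha> < 1" "filterlim (M_index x) at_top sequentially"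
    using that by (rule conv(1))
  show ?conv if "\<alpha> = 1" "(\<lambda>N. (real_of_int (M_index x N) + real (k_index x N) + 1) *
      real q powr (- real_of_int (M_index x N) / 2)) \<longlonglongrightarrow> 0"
    using that by (rule conv(2))
  show gt_1: ?conv if "1 < \<alpha>" "filterlim (\<lambda>N. - ((2 - \<alpha>) / 2) * real_of_int (M_index x N)
      + (\<alpha> - 1) * real (k_index x N)) at_bot sequentially"
    using that by (rule conv(3))
  fix \<theta> :: real
  assume "1 < \<alpha>" "0 \<le> \<theta>" "\<theta> < (2 - \<alpha>) / (2 * (\<alpha> - 1))"
    "\<forall>\<^sub>F N in sequentially. real (k_index x N) \<le> \<theta> * real_of_int (M_index x N)"
  then show ?conv
    using \<alpha> by (intro gt_1 exponent_at_bot_of_sublinear) (auto simp: M_index_def)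
qed

end
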